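(* Let $k\ge1$ be a fixed constant. There is $f\in\mathcal{D}^{(k)}$ such that $\bar{\mathrm{R}}_\varepsilon(f)\ge\Omega(\varepsilon^{-1/(k+1)})$.
   Context: $\mathcal{D}^{(k)}$ is the set of $k$-times differentiable functions $f:[0,1]^2\to[-1,1]$ all of whose $k$-th order partial derivatives $\partial^k f/\partial x^i\partial y^{k-i}$ ($0\le i\le k$) take values in $[-1,1]$. Distributed estimation: Alice holds a probability distribution $p$ on $[0,1]$, Bob a probability distribution $q$ on $[0,1]$, and they must output an estimate within additive error $\varepsilon$ of $\mathbb{E}_{x\sim p,y\sim q}[f(x,y)]$. $\bar{\mathrm{R}}_\varepsilon(f)$ is the minimum worst-case communication of a shared-randomness randomized protocol succeeding with probability at least $2/3$ on every input pair. $\Omega$ hides a constant that may depend on $k$. *)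

theory Defs
  imports "HOL-Probability.Probability"
begin

abbreviation unit_square :: "(real \<times> real) set" where
  "unit_square \<equiv> {0..1} \<times> {0..1}"

text \<open>
  Partial derivatives on the closed unit square are taken within \<open>{0..1}\<close>, so they are one-sided
  on the boundary. The values of these functions outside the square are never used.
\<close>

definition partial_x :: "(real \<times> real \<Rightarrow> real) \<Rightarrow> real \<times> real \<Rightarrow> real" where
  "partial_x f z = vector_derivative (\<lambda>t. f (t, snd z)) (at (fst z) within {0..1})"

definition partial_y :: "(real \<times> real \<Rightarrow> real) \<Rightarrow> real \<times> real \<Rightarrow> real" where
  "partial_y f z = vector_derivative (\<lambda>t. f (fst z, t)) (at (snd z) within {0..1})"

primrec times_differentiable :: "nat \<Rightarrow> (real \<times> real \<Rightarrow> real) \<Rightarrow> bool" where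
  "times_differentiable 0 f \<longleftrightarrow> True"
| "times_differentiable (Suc n) f \<longleftrightarrow> f differentiable_on unit_square \<and>
     times_differentiable n (partial_x f) \<and> times_differentiable n (partial_y f)"

definition smooth_class :: "nat \<Rightarrow> (real \<times> real \<Rightarrow> real) set" where
  "smooth_class k = {f. times_differentiable k f \<and>
     (\<forall>z\<in>unit_square. f z \<in> {-1..1}) \<and>
     (\<forall>i\<le>k. \<forall>z\<in>unit_square. (partial_x ^^ i) ((partial_y ^^ (k - i)) f) z \<in> {-1..1})}"

definition unit_distributions :: "real measure set" where
  "unit_distributions = {p. prob_space p \<and> sets p = sets (restrict_space borel {0..1})}"

text \<open>
  Deterministic two-party protocols are binary trees. At an inner node the named player sends one
  bit, an arbitrary function of that player's input. At a leaf the transcript determines the output.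
\<close>

datatype ('a, 'b) protocol =
    Output real
  | Alice "'a \<Rightarrow> bool" "('a, 'b) protocol" "('a, 'b) protocol"
  | Bob "'b \<Rightarrow> bool" "('a, 'b) protocol" "('a, 'b) protocol"

primrec run :: "('a, 'b) protocol \<Rightarrow> 'a \<Rightarrow> 'b \<Rightarrow> real" where
  "run (Output r) x y = r"
| "run (Alice m P Q) x y = (if m x then run P x y else run Q x y)"
| "run (Bob m P Q) x y = (if m y then run P x y else run Q x y)"

primrec depth :: "('a, 'b) protocol \<Rightarrow> nat" where
  "depth (Output r) = 0"
| "depth (Alice m P Q) = Suc (max (depth P) (depth Q))"
| "depth (Bob m P Q) = Suc (max (depth P) (depth Q))"

text \<open>
  A shared-randomness protocol is a probability measure on deterministic protocols. The sigma-algebra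
  is arbitrary, so every space of shared seeds is covered by pushing it forward along the map from
  seeds to protocols. The success events need no separate measurability condition: \<open>measure\<close> is 0 on
  non-measurable sets.
\<close>

definition estimates ::
  "(real measure, real measure) protocol measure \<Rightarrow> real \<Rightarrow> (real \<times> real \<Rightarrow> real) \<Rightarrow> bool" where
  "estimates M \<epsilon> f \<longleftrightarrow> prob_space M \<and>
     (\<forall>p\<in>unit_distributions. \<forall>q\<in>unit_distributions.
        measure M {P \<in> space M. \<bar>run P p q - (\<integral>z. f z \<partial>(p \<Otimes>\<^sub>M q))\<bar> \<le> \<epsilon>} \<ge> 2 / 3)"

text \<open>The value is \<open>\<infinity>\<close> if no protocol of bounded depth succeeds.\<close>

definition estimation_complexity :: "real \<Rightarrow> (real \<times> real \<Rightarrow> real) \<Rightarrow> enat" where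
  "estimation_complexity \<epsilon> f =
     Inf {enat d | d. \<exists>M. estimates M \<epsilon> f \<and> (\<forall>P\<in>space M. depth P \<le> d)}"

end

theory Submission
  imports Defs
begin

text \<open>
  Take \<open>f(x, y) = amp * cos (2 pi n x y - pi / 4)\<close> with \<open>amp\<close> of order \<open>n ^ (-k)\<close>, so that \<open>f\<close> restricted
  to the grid of multiples of \<open>1 / n\<close> is a multiple of an orthogonal \<open>n\<close> by \<open>n\<close> matrix \<open>A\<close>. Alice holds
  the uniform distribution on a set \<open>S\<close> of grid points and Bob a distribution proportional to an
  integer vector \<open>y\<close> in a large cube, so the expectation is a multiple of \<open>1\<^sub>S \<bullet> A y\<close>, and an
  error of order \<open>n ^ (-k-1)\<close> means knowing this form up to a small multiple of its standard deviation.

  On a rectangle \<open>X \<times> Y\<close> of density \<open>2 ^ (- O(n))\<close> the form cannot be concentrated in such a window.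
  Otherwise one selects greedily \<open>m = n / 100\<close> sets in \<open>X\<close>, each with indicator far from the span of the
  previous ones, for which a fraction at least \<open>12 ^ (-m) / 6\<close> of \<open>Y\<close> lies in all \<open>m\<close> windows. Moving
  these \<open>y\<close> along the Gram-Schmidt directions of the selected sets gives \<open>R ^ m\<close> disjoint translates
  inside an \<open>l\<^sup>1\<close>-ball only \<open>2 ^ (O(n))\<close> times larger than the cube, a contradiction for large \<open>R\<close>.
  Since a protocol of depth \<open>d\<close> partitions the inputs into \<open>2 ^ d\<close> rectangles, averaging over the shared
  randomness yields \<open>d > m\<close>.
\<close>

section \<open>Orthonormal families and counting\<close>

definition ip :: "nat \<Rightarrow> (nat \<Rightarrow> real) \<Rightarrow> (nat \<Rightarrow> real) \<Rightarrow> real" where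
  "ip n u v = (\<Sum>j<n. u j * v j)"

definition lincomb :: "nat \<Rightarrow> (nat \<Rightarrow> real) \<Rightarrow> (nat \<Rightarrow> nat \<Rightarrow> real) \<Rightarrow> nat \<Rightarrow> real" where
  "lincomb k c e = (\<lambda>j. \<Sum>l<k. c l * e l j)"

definition orthonormal :: "nat \<Rightarrow> nat \<Rightarrow> (nat \<Rightarrow> nat \<Rightarrow> real) \<Rightarrow> bool" where
  "orthonormal n k e \<longleftrightarrow> (\<forall>i<k. \<forall>l<k. ip n (e i) (e l) = (if i = l then 1 else 0))"

lemma ip_commute: "ip n u v = ip n v u"
  by (simp add: ip_def mult.commute)

lemma ip_self_nonneg: "0 \<le> ip n u u"
  by (simp add: ip_def sum_nonneg)

lemma ip_diff_left: "ip n (\<lambda>j. u j - v j) w = ip n u w - ip n v w"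
  by (simp add: ip_def left_diff_distrib sum_subtractf)

lemma ip_diff_right: "ip n w (\<lambda>j. u j - v j) = ip n w u - ip n w v"
  by (simp add: ip_def right_diff_distrib sum_subtractf)

lemma ip_scale_right: "ip n u (\<lambda>j. c * v j) = c * ip n u v"
  by (simp add: ip_def sum_distrib_left mult_ac)

lemma ip_lincomb_right: "ip n u (lincomb k c e) = (\<Sum>l<k. c l * ip n u (e l))"
proof -
  have "ip n u (lincomb k c e) = (\<Sum>j<n. \<Sum>l<k. c l * (u j * e l j))"
    by (simp add: ip_def lincomb_def sum_distrib_left mult_ac)
  also have "\<dots> = (\<Sum>l<k. \<Sum>j<n. c l * (u j * e l j))"
    by (rule sum.swap)
  finally show ?thesis by (simp add: ip_def sum_distrib_left)
qed

lemma ip_lincomb_basis: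
  assumes "orthonormal n k e" "l < k"
  shows "ip n (e l) (lincomb k c e) = c l"
proof -
  have "ip n (e l) (lincomb k c e) = (\<Sum>i<k. if i = l then c i else 0)"
    unfolding ip_lincomb_right using assms by (intro sum.cong) (auto simp: orthonormal_def)
  then show ?thesis using assms(2) by simp
qed

lemma norm_lincomb:
  assumes "orthonormal n k e"
  shows "ip n (lincomb k c e) (lincomb k c e) = (\<Sum>l<k. (c l)\<^sup>2)"
proof -
  have "ip n (lincomb k c e) (lincomb k c e) = (\<Sum>l<k. c l * ip n (lincomb k c e) (e l))"
    by (rule ip_lincomb_right)
  also have "\<dots> = (\<Sum>l<k. (c l)\<^sup>2)"
    using ip_lincomb_basis[OF assms]
    by (intro sum.cong) (auto simp: ip_commute[of n "lincomb k c e"] power2_eq_square)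
  finally show ?thesis .
qed

text \<open>For an orthonormal family this is the Gram-Schmidt remainder: \<open>u\<close> minus its
  projection onto the span of the first \<open>k\<close> vectors.\<close>

definition residual :: "nat \<Rightarrow> nat \<Rightarrow> (nat \<Rightarrow> nat \<Rightarrow> real) \<Rightarrow> (nat \<Rightarrow> real) \<Rightarrow> nat \<Rightarrow> real" where
  "residual n k e u = (\<lambda>j. u j - lincomb k (\<lambda>l. ip n u (e l)) e j)"

lemma residual_orthogonal:
  assumes "orthonormal n k e" "l < k"
  shows "ip n (e l) (residual n k e u) = 0"
  unfolding residual_def ip_diff_right ip_lincomb_basis[OF assms]
  by (simp add: ip_commute)

lemma ip_residual_self:
  assumes "orthonormal n k e"
  shows "ip n u (residual n k e u) = ip n (residual n k e u) (residual n k e u)"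
proof -
  have "ip n (lincomb k c e) (residual n k e u) = 0" for c
    unfolding ip_commute[of n "lincomb k c e"] ip_lincomb_right
    using residual_orthogonal[OF assms] by (simp add: ip_commute)
  moreover have "ip n (residual n k e u) w = ip n u w - ip n (lincomb k (\<lambda>l. ip n u (e l)) e) w" for w
    by (simp add: residual_def ip_diff_left)
  ultimately show ?thesis by simp
qed

lemma bessel:
  assumes "orthonormal n k e"
  shows "(\<Sum>l<k. (ip n u (e l))\<^sup>2) \<le> ip n u u"
proof -
  have "ip n u (residual n k e u) = ip n u u - (\<Sum>l<k. (ip n u (e l))\<^sup>2)"
    by (simp add: residual_def ip_diff_right ip_lincomb_right power2_eq_square)
  then show ?thesis
    using ip_residual_self[OF assms] ip_self_nonneg by (metis diff_ge_0_iff_ge)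
qed

text \<open>One Gram-Schmidt step. The last conclusion says by duality that \<open>u\<close> lies in
  the span of \<open>e' 0\<close>, ..., \<open>e' k\<close>; in this form it survives later
  extensions and yields a triangular pattern of inner products.\<close>

lemma orthonormal_extend:
  assumes e: "orthonormal n k e" and r: "0 < ip n (residual n k e u) (residual n k e u)"
  defines "r \<equiv> residual n k e u"
  defines "e' \<equiv> e(k := (\<lambda>j. (1 / sqrt (ip n r r)) * r j))"
  shows "orthonormal n (Suc k) e'" "ip n u (e' k) = sqrt (ip n r r)"
    "(\<And>v. (\<And>l. l \<le> k \<Longrightarrow> ip n v (e' l) = 0) \<Longrightarrow> ip n v u = 0)"
proof -
  let ?s = "sqrt (ip n r r)"
  have s: "?s > 0" "?s * ?s = ip n r r" using r by (simp_all add: r_def)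
  have scale: "ip n v (e' k) = (1 / ?s) * ip n v r" for v
    unfolding e'_def fun_upd_same by (rule ip_scale_right)
  have kk: "ip n (e' k) (e' k) = 1"
    using s unfolding scale ip_commute[of n "e' k"] by (simp add: field_simps)
  have kl: "ip n (e' k) (e l) = 0" "ip n (e l) (e' k) = 0" if "l < k" for l
    using residual_orthogonal[OF e that, of u]
    unfolding ip_commute[of n "e' k"] scale r_def by simp_all
  show "orthonormal n (Suc k) e'"
    using e kk kl by (auto simp: orthonormal_def less_Suc_eq e'_def)
  have "ip n u (e' k) = (1 / ?s) * ip n r r"
    using ip_residual_self[OF e, of u] unfolding e'_def fun_upd_same ip_scale_right r_def by simp
  then show "ip n u (e' k) = ?s"
    using s by (metis divide_inverse inverse_eq_divide mult.commute nonzero_mult_div_cancel_left order_less_irrefl)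
  show "ip n v u = 0" if v: "\<And>l. l \<le> k \<Longrightarrow> ip n v (e' l) = 0" for v
  proof -
    have "(1 / ?s) * ip n v r = 0"
      using v[of k] unfolding e'_def fun_upd_same ip_scale_right by simp
    then have "ip n v r = 0" using s by simp
    moreover have "ip n v (e l) = 0" if "l < k" for l
      using v[of l] that by (simp add: e'_def)
    then have "ip n v (lincomb k c e) = 0" for c
      by (simp add: ip_lincomb_right)
    ultimately show ?thesis unfolding r_def residual_def ip_diff_right by simp
  qed
qed

lemma sum_abs_le_sqrt:
  fixes f :: "nat \<Rightarrow> real"
  shows "(\<Sum>i<n. \<bar>f i\<bar>) \<le> sqrt (real n * (\<Sum>i<n. (f i)\<^sup>2))"
proof (rule real_le_rsqrt)
  show "(\<Sum>i<n. \<bar>f i\<bar>)\<^sup>2 \<le> real n * (\<Sum>i<n. (f i)\<^sup>2)"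
    using sum_squared_le_sum_of_squares[of "\<lambda>i. \<bar>f i\<bar>" "{..<n}"] by (simp add: mult.commute)
qed

section \<open>Counting integer vectors and small subsets by exponential weights\<close>

lemma sum_power_abs_le:
  fixes q :: real
  assumes "0 < q" "q < 1"
  shows "(\<Sum>z\<in>{- int K..int K}. q ^ nat \<bar>z\<bar>) \<le> (1 + q) / (1 - q)"
proof -
  have geo: "(\<Sum>i\<le>K. q ^ i) \<le> 1 / (1 - q)" "(\<Sum>i\<in>{1..K}. q ^ i) \<le> q / (1 - q)"
  proof -
    show 1: "(\<Sum>i\<le>K. q ^ i) \<le> 1 / (1 - q)" for K
      using assms by (simp add: sum_gp0 divide_right_mono)
    have "(\<Sum>i\<in>{1..K}. q ^ i) = (\<Sum>i<K. q * q ^ i)"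
      by (rule sum.reindex_bij_witness[of _ Suc "\<lambda>i. i - 1"]) (auto simp flip: power_Suc)
    also have "\<dots> \<le> q * (\<Sum>i\<le>K. q ^ i)"
      unfolding sum_distrib_left using assms by (intro sum_mono2) auto
    also have "\<dots> \<le> q * (1 / (1 - q))" using assms 1 by (intro mult_left_mono) auto
    finally show "(\<Sum>i\<in>{1..K}. q ^ i) \<le> q / (1 - q)" by simp
  qed
  have split: "{- int K..int K} = int ` {..K} \<union> (\<lambda>i. - int i) ` {1..K}"
  proof (intro set_eqI iffI)
    fix z assume "z \<in> {- int K..int K}"
    then show "z \<in> int ` {..K} \<union> (\<lambda>i. - int i) ` {1..K}"
      by (cases "z \<ge> 0") (auto intro!: image_eqI[of _ _ "nat \<bar>z\<bar>"])
  qed auto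
  have "(\<Sum>z\<in>{- int K..int K}. q ^ nat \<bar>z\<bar>) =
      (\<Sum>z\<in>int ` {..K}. q ^ nat \<bar>z\<bar>) + (\<Sum>z\<in>(\<lambda>i. - int i) ` {1..K}. q ^ nat \<bar>z\<bar>)"
    unfolding split by (rule sum.union_disjoint) auto
  also have "\<dots> = (\<Sum>i\<le>K. q ^ i) + (\<Sum>i\<in>{1..K}. q ^ i)"
    by (subst sum.reindex, simp add: inj_on_def)+ simp
  also have "\<dots> \<le> 1 / (1 - q) + q / (1 - q)" using geo by (intro add_mono)
  finally show ?thesis by (simp add: add_divide_distrib)
qed

text \<open>Exponential Markov: each vector in the \<open>l\<^sup>1\<close>-ball has weight \<open>q ^ (\<Sum>j<n. \<bar>z j\<bar>)\<close> at least \<open>q ^ B\<close>.\<close>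

lemma card_l1_ball:
  fixes q :: real and n B :: nat
  assumes q: "0 < q" "q < 1"
  defines "Z \<equiv> {z \<in> PiE {..<n} (\<lambda>_. UNIV::int set). (\<Sum>j<n. \<bar>z j\<bar>) \<le> int B}"
  shows "finite Z" "q ^ B * real (card Z) \<le> ((1 + q) / (1 - q)) ^ n"
proof -
  let ?P = "PiE {..<n} (\<lambda>_. {- int B..int B})"
  have sub: "Z \<subseteq> ?P"
  proof
    fix z assume z: "z \<in> Z"
    have "\<bar>z j\<bar> \<le> int B" if "j < n" for j
      using z member_le_sum[of j "{..<n}" "\<lambda>j. \<bar>z j\<bar>"] that by (auto simp: Z_def)
    then show "z \<in> ?P" using z by (force simp: Z_def PiE_iff abs_le_iff)
  qed
  have finP: "finite ?P" by (intro finite_PiE) auto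
  show "finite Z" using sub finP by (rule finite_subset)
  have w: "q ^ B \<le> (\<Prod>j<n. q ^ nat \<bar>z j\<bar>)" if "z \<in> Z" for z
  proof -
    have "(\<Prod>j<n. q ^ nat \<bar>z j\<bar>) = q ^ (\<Sum>j<n. nat \<bar>z j\<bar>)" by (simp add: power_sum)
    moreover have "int (\<Sum>j<n. nat \<bar>z j\<bar>) \<le> int B" using that by (simp add: Z_def)
    then have "(\<Sum>j<n. nat \<bar>z j\<bar>) \<le> B" by (simp only: of_nat_le_iff)
    ultimately show ?thesis using q by (simp only:) (intro power_decreasing, auto)
  qed
  have "q ^ B * real (card Z) = (\<Sum>z\<in>Z. q ^ B)" by simp
  also have "\<dots> \<le> (\<Sum>z\<in>Z. \<Prod>j<n. q ^ nat \<bar>z j\<bar>)" by (intro sum_mono w)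
  also have "\<dots> \<le> (\<Sum>z\<in>?P. \<Prod>j<n. q ^ nat \<bar>z j\<bar>)"
    using sub finP q by (intro sum_mono2) (auto intro!: prod_nonneg)
  also have "\<dots> = (\<Prod>j<n. \<Sum>z\<in>{- int B..int B}. q ^ nat \<bar>z\<bar>)"
    by (subst prod_sum_PiE) auto
  also have "\<dots> = (\<Sum>z\<in>{- int B..int B}. q ^ nat \<bar>z\<bar>) ^ n" by simp
  also have "\<dots> \<le> ((1 + q) / (1 - q)) ^ n"
    using q by (intro power_mono sum_power_abs_le) (auto intro: sum_nonneg)
  finally show "q ^ B * real (card Z) \<le> ((1 + q) / (1 - q)) ^ n" .
qed

text \<open>Exponential weights again: each counted set weighs at least \<open>r ^ B\<close>, and
  all subsets together weigh \<open>(1 + r) ^ n\<close>, since every element contributes a factor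
  \<open>1\<close> or \<open>r\<close>.\<close>

lemma card_small_subsets:
  fixes r :: real
  assumes "0 < r" "r < 1"
  shows "r ^ B * real (card {D. D \<subseteq> {..<n::nat} \<and> card D \<le> B}) \<le> (1 + r) ^ n"
proof -
  let ?Z = "{D. D \<subseteq> {..<n} \<and> card D \<le> B}"
  have "r ^ B * real (card ?Z) = (\<Sum>D\<in>?Z. r ^ B)" by simp
  also have "\<dots> \<le> (\<Sum>D\<in>?Z. r ^ card D)"
    using assms by (intro sum_mono) (auto intro: power_decreasing)
  also have "\<dots> \<le> (\<Sum>D\<in>Pow {..<n}. r ^ card D)"
    using assms by (intro sum_mono2) auto
  also have "\<dots> = (\<Prod>j<n. r + 1)"
    by (subst prod_add) auto
  finally show ?thesis by (simp add: add.commute)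
qed

section \<open>Sets far from a subspace\<close>

text \<open>Truncation instead of the floor: absolute values do not grow, so an l1 bound on real
  coordinates passes to their integer parts.\<close>

definition toward_zero :: "real \<Rightarrow> int" where
  "toward_zero x = (if 0 \<le> x then \<lfloor>x\<rfloor> else \<lceil>x\<rceil>)"

lemma toward_zero_bounds:
  "real_of_int \<bar>toward_zero x\<bar> \<le> \<bar>x\<bar>" "(x - real_of_int (toward_zero x))\<^sup>2 \<le> 1"
proof -
  show "real_of_int \<bar>toward_zero x\<bar> \<le> \<bar>x\<bar>" unfolding toward_zero_def by (cases "0 \<le> x") (auto; linarith)+
  have "\<bar>x - real_of_int (toward_zero x)\<bar> \<le> 1" unfolding toward_zero_def by (cases "0 \<le> x") (auto; linarith)+
  then show "(x - real_of_int (toward_zero x))\<^sup>2 \<le> 1" by (simp add: abs_square_le_1)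
qed

text \<open>
  A set whose indicator is close to a subspace of dimension \<open>k\<close> is determined, up to few elements,
  by the integer parts of its \<open>k\<close> coordinates in an orthonormal basis.
\<close>

lemma card_near_subspace:
  fixes m k n :: nat
  assumes n: "n = 100 * m" and e: "orthonormal n k e" and k: "k \<le> m"
  defines "Bad \<equiv> {S. S \<subseteq> {..<n} \<and>
    ip n (residual n k e (indicator S)) (residual n k e (indicator S)) < real m}"
  shows "real (card Bad) \<le> 2 ^ (77 * m)"
proof -
  define a where "a S l = ip n (indicator S) (e l)" for S l
  define code where "code S = restrict (\<lambda>l. toward_zero (a S l)) {..<k}" for S
  define Z where "Z = {z \<in> PiE {..<k} (\<lambda>_. UNIV::int set). (\<Sum>j<k. \<bar>z j\<bar>) \<le> int (10 * m)}"
  \<comment> \<open>\<open>thr z\<close> rounds the approximating vector back to a 0/1 vector by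
    cutting at 1/2; \<open>D S\<close> is where this rounding misses \<open>S\<close>.\<close>
  define thr where "thr z = {j. j < n \<and> 1 / 2 \<le> lincomb k (\<lambda>l. real_of_int (z l)) e j}" for z
  define D where "D S = (S - thr (code S)) \<union> (thr (code S) - S)" for S
  define E where "E = {D. D \<subseteq> {..<n} \<and> card D \<le> 16 * m}"
  have code: "code S \<in> Z" if "S \<in> Bad" for S
  proof -
    \<comment> \<open>Bessel bounds the sum of squared coordinates by \<open>n\<close>;
      Cauchy-Schwarz turns this into the l1 bound \<open>sqrt (m * 100 m) = 10 m\<close>.\<close>
    have "(\<Sum>l<k. (a S l)\<^sup>2) \<le> ip n (indicator S) (indicator S)"
      unfolding a_def by (rule bessel[OF e])
    also have "\<dots> \<le> (\<Sum>j<n. 1)"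
      unfolding ip_def by (intro sum_mono) (auto simp: indicator_def)
    finally have a2: "(\<Sum>l<k. (a S l)\<^sup>2) \<le> real n" by simp
    have "(\<Sum>l<k. real_of_int \<bar>toward_zero (a S l)\<bar>) \<le> (\<Sum>l<k. \<bar>a S l\<bar>)"
      by (intro sum_mono toward_zero_bounds)
    also have "\<dots> \<le> sqrt (real k * (\<Sum>l<k. (a S l)\<^sup>2))" by (rule sum_abs_le_sqrt)
    also have "\<dots> \<le> sqrt (real m * real n)"
      using a2 k by (intro real_sqrt_le_mono mult_mono) (auto intro: sum_nonneg)
    also have "real m * real n = (10 * real m)\<^sup>2" by (simp add: n power2_eq_square)
    also have "sqrt ((10 * real m)\<^sup>2) = 10 * real m" by (simp only: real_sqrt_abs)
    finally have "(\<Sum>l<k. real_of_int \<bar>toward_zero (a S l)\<bar>) \<le> 10 * real m" .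
    then have "real_of_int (\<Sum>l<k. \<bar>toward_zero (a S l)\<bar>) \<le> real_of_int (int (10 * m))" by simp
    then have "(\<Sum>l<k. \<bar>toward_zero (a S l)\<bar>) \<le> int (10 * m)" by (simp only: of_int_le_iff)
    then show ?thesis by (simp add: Z_def code_def)
  qed
  have D: "D S \<in> E" if "S \<in> Bad" for S
  proof -
    let ?v = "lincomb k (a S) e" and ?w = "lincomb k (\<lambda>l. real_of_int (code S l)) e"
    have sub: "D S \<subseteq> {..<n}" using that by (auto simp: D_def Bad_def thr_def)
    have res: "residual n k e (indicator S) = (\<lambda>j. indicator S j - ?v j)"
      unfolding residual_def a_def[abs_def] ..
    have r: "(\<Sum>j<n. (indicator S j - ?v j)\<^sup>2) \<le> real m"
      using that by (simp add: Bad_def res ip_def power2_eq_square)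
    have "(\<Sum>j<n. (?v j - ?w j)\<^sup>2) = (\<Sum>l<k. (a S l - real_of_int (code S l))\<^sup>2)"
      using norm_lincomb[OF e, of "\<lambda>l. a S l - real_of_int (code S l)"]
      by (simp add: ip_def lincomb_def sum_subtractf left_diff_distrib power2_eq_square)
    also have "\<dots> \<le> (\<Sum>l<k. 1)"
      by (intro sum_mono) (simp add: code_def toward_zero_bounds)
    finally have w: "(\<Sum>j<n. (?v j - ?w j)\<^sup>2) \<le> real m" using k by simp
    \<comment> \<open>Each misplaced position costs at least 1/4 in squared error, and the total is
      at most \<open>4 m\<close>: half from the distance to the subspace, half from truncating
      coefficients. Hence the \<open>16 * m\<close> in \<open>E\<close>.\<close>
    have "real (card (D S)) / 4 = (\<Sum>j\<in>D S. 1 / 4)" by simp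
    also have "\<dots> \<le> (\<Sum>j\<in>D S. (indicator S j - ?w j)\<^sup>2)"
    proof (rule sum_mono)
      fix j assume j: "j \<in> D S"
      then have "1 / 2 \<le> \<bar>indicator S j - ?w j\<bar>"
        using sub by (auto simp: D_def thr_def)
      then have "(1 / 2)\<^sup>2 \<le> \<bar>indicator S j - ?w j\<bar>\<^sup>2" by (rule power_mono) simp
      then show "1 / 4 \<le> (indicator S j - ?w j)\<^sup>2" by (simp add: power2_eq_square)
    qed
    also have "\<dots> \<le> (\<Sum>j<n. (indicator S j - ?w j)\<^sup>2)"
      using sub by (intro sum_mono2) auto
    also have "\<dots> \<le> (\<Sum>j<n. 2 * (indicator S j - ?v j)\<^sup>2 + 2 * (?v j - ?w j)\<^sup>2)"
    proof (rule sum_mono)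
      fix j
      have "(x - z)\<^sup>2 \<le> 2 * (x - y)\<^sup>2 + 2 * (y - z)\<^sup>2" for x y z :: real
        using zero_le_power2[of "x - 2 * y + z"] by (simp add: power2_eq_square algebra_simps)
      then show "(indicator S j - ?w j)\<^sup>2 \<le> 2 * (indicator S j - ?v j)\<^sup>2 + 2 * (?v j - ?w j)\<^sup>2" .
    qed
    also have "\<dots> \<le> 4 * real m" using r w by (simp add: sum.distrib flip: sum_distrib_left)
    finally show ?thesis using sub by (simp add: E_def)
  qed
  have inj: "inj_on (\<lambda>S. (code S, D S)) Bad"
  proof (rule inj_onI)
    fix S T assume eq: "(code S, D S) = (code T, D T)"
    \<comment> \<open>A second symmetric difference with \<open>thr (code U)\<close> undoes the
      first, so code and error set determine the set.\<close>
    have "U = (thr (code U) - D U) \<union> (D U - thr (code U))" for U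
      unfolding D_def by blast
    then show "S = T" using eq by (metis prod.inject)
  qed
  have finZ: "finite Z" and cZ: "(1 / 2) ^ (10 * m) * real (card Z) \<le> 3 ^ k"
    using card_l1_ball[where q = "1 / 2" and n = k and B = "10 * m"] by (simp_all add: Z_def)
  have finE: "finite E" unfolding E_def by (rule finite_subset[of _ "Pow {..<n}"]) auto
  have cE: "(1 / 4) ^ (16 * m) * real (card E) \<le> (5 / 4) ^ n"
    using card_small_subsets[of "1 / 4" "16 * m" n] by (simp add: E_def)
  have "card Bad \<le> card (Z \<times> E)"
    using inj code D finZ finE by (intro card_inj_on_le[of "\<lambda>S. (code S, D S)"]) auto
  then have "real (card Bad) \<le> real (card Z) * real (card E)"
    by (simp add: card_cartesian_product flip: of_nat_mult)
  \<comment> \<open>Exponents: \<open>12 = 10 + 2\<close> since \<open>3 ^ k\<close> is at most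
    \<open>4 ^ m\<close>, and \<open>65 = 32 + 33\<close> from \<open>4 ^ (16 m)\<close> and
    \<open>(5 / 4) ^ 100 <= 2 ^ 33\<close>.\<close>
  also have "\<dots> \<le> 2 ^ (12 * m) * 2 ^ (65 * m)"
  proof (rule mult_mono)
    have "real (card Z) = 2 ^ (10 * m) * ((1 / 2) ^ (10 * m) * real (card Z))"
      by (simp add: power_one_over)
    also have "\<dots> \<le> 2 ^ (10 * m) * 3 ^ k" using cZ by (intro mult_left_mono) auto
    also have "(3::real) ^ k \<le> 4 ^ k" by (intro power_mono) auto
    also have "(4::real) ^ k \<le> 4 ^ m" using k by (intro power_increasing) auto
    also have "(4::real) ^ m = 2 ^ (2 * m)" by (simp add: power_mult)
    finally show "real (card Z) \<le> 2 ^ (12 * m)" by (simp flip: power_add)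
    have "real (card E) = 4 ^ (16 * m) * ((1 / 4) ^ (16 * m) * real (card E))"
      by (simp add: power_one_over)
    also have "\<dots> \<le> 4 ^ (16 * m) * (5 / 4) ^ n" using cE by (intro mult_left_mono) auto
    also have "(5 / 4 :: real) ^ n = ((5 / 4) ^ 100) ^ m" by (simp only: n power_mult)
    also have "\<dots> \<le> (2 ^ 33) ^ m" by (intro power_mono) (auto simp: power_divide divide_le_eq)
    also have "(4::real) ^ (16 * m) * (2 ^ 33) ^ m = 2 ^ (65 * m)"
    proof -
      have "(4::real) ^ (16 * m) = (2\<^sup>2) ^ (16 * m)" by simp
      then show ?thesis by (simp only: power_mult[symmetric] power_add[symmetric]) simp
    qed
    finally show "real (card E) \<le> 2 ^ (65 * m)" by simp
  qed auto
  also have "\<dots> = 2 ^ (77 * m)" by (simp flip: power_add)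
  finally show ?thesis .
qed

text \<open>Induction on \<open>k\<close>. Sets near the current span are few by
  \<open>card_near_subspace\<close>; once they are removed, averaging the incidences finds one set
  good for a twelfth of the current \<open>Y'\<close>, whence the factor \<open>12 ^ k\<close>. Its
  residual supplies the next direction and the lower bound \<open>sqrt m\<close>. The last conjunct
  places the indicator of \<open>S l\<close> in the span of \<open>e 0\<close>, ...,
  \<open>e l\<close>.\<close>

lemma greedy_selection:
  fixes m n :: nat and X :: "nat set set" and Y :: "'b set"
  assumes n: "n = 100 * m" and m: "m \<ge> 1" and X: "X \<subseteq> Pow {..<n}" "2 ^ (96 * m) \<le> real (card X)"
    and Y: "finite Y" "\<And>y. y \<in> Y \<Longrightarrow> real (card X) / 6 \<le> real (card {S \<in> X. G S y})"
    and k: "k \<le> m"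
  shows "\<exists>S e Y'. Y' \<subseteq> Y \<and> real (card Y) \<le> 12 ^ k * real (card Y') \<and> orthonormal n k e \<and>
    (\<forall>l<k. S l \<in> X \<and> (\<forall>y\<in>Y'. G (S l) y) \<and> sqrt (real m) \<le> ip n (indicator (S l)) (e l) \<and>
       (\<forall>v. (\<forall>i\<le>l. ip n v (e i) = 0) \<longrightarrow> ip n v (indicator (S l)) = 0))"
  using k
proof (induction k)
  case 0
  show ?case by (rule exI[of _ undefined], rule exI[of _ undefined], rule exI[of _ Y])
      (simp add: orthonormal_def)
next
  case (Suc k)
  then have "k \<le> m" by simp
  from Suc.IH[OF this] obtain S e Y' where IH: "Y' \<subseteq> Y" "real (card Y) \<le> 12 ^ k * real (card Y')" "orthonormal n k e"
    "\<And>l. l < k \<Longrightarrow> S l \<in> X" "\<And>l y. l < k \<Longrightarrow> y \<in> Y' \<Longrightarrow> G (S l) y"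
    "\<And>l. l < k \<Longrightarrow> sqrt (real m) \<le> ip n (indicator (S l)) (e l)"
    "\<And>l v. l < k \<Longrightarrow> (\<forall>i\<le>l. ip n v (e i) = 0) \<Longrightarrow> ip n v (indicator (S l)) = 0"
    by metis
  let ?r = "\<lambda>T. residual n k e (indicator T)"
  define Bad where "Bad = {T. T \<subseteq> {..<n} \<and> ip n (?r T) (?r T) < real m}"
  define X' where "X' = X - Bad"
  have finX: "finite X" using X(1) by (rule finite_subset) auto
  have finY': "finite Y'" using IH(1) Y(1) by (rule finite_subset)
  have finBad: "finite Bad" unfolding Bad_def by (rule finite_subset[of _ "Pow {..<n}"]) auto
  have "real (card Bad) \<le> 2 ^ (77 * m)"
    unfolding Bad_def using Suc.prems by (intro card_near_subspace[OF n IH(3)]) auto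
  \<comment> \<open>Bad sets make up at most a twelfth of \<open>X\<close>, so each
    \<open>y\<close>, which starts with a sixth of \<open>X\<close>, keeps a twelfth.\<close>
  moreover have "12 * (2::real) ^ (77 * m) \<le> 2 ^ (96 * m)"
  proof -
    have "(12::real) \<le> 2 ^ 19" by simp
    also have "(2::real) ^ 19 \<le> 2 ^ (19 * m)" using m by (intro power_increasing) auto
    finally have "12 * (2::real) ^ (77 * m) \<le> 2 ^ (19 * m) * 2 ^ (77 * m)" by (intro mult_right_mono) auto
    also have "\<dots> = 2 ^ (96 * m)" by (simp flip: power_add)
    finally show ?thesis .
  qed
  ultimately have bad: "12 * real (card Bad) \<le> real (card X)" using X(2) by linarith
  have Xpos: "0 < real (card X)" using X(2) by (meson less_le_trans zero_less_numeral zero_less_power)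
  have "X' \<noteq> {}"
  proof
    assume "X' = {}"
    then have "card X \<le> card Bad" using finBad by (intro card_mono) (auto simp: X'_def)
    then show False using bad Xpos by linarith
  qed
  have deg: "real (card X) / 12 \<le> real (card {T \<in> X'. G T y})" if "y \<in> Y'" for y
  proof -
    have "{T \<in> X. G T y} \<subseteq> {T \<in> X'. G T y} \<union> Bad" by (auto simp: X'_def)
    then have "card {T \<in> X. G T y} \<le> card ({T \<in> X'. G T y} \<union> Bad)"
      using finX finBad by (intro card_mono) (auto simp: X'_def)
    also have "\<dots> \<le> card {T \<in> X'. G T y} + card Bad" by (rule card_Un_le)
    finally show ?thesis using Y(2)[of y] IH(1) that bad by force
  qed
  have "\<exists>T\<in>X'. real (card Y') / 12 \<le> real (card {y \<in> Y'. G T y})"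
  proof (rule ccontr)
    assume "\<not> ?thesis"
    then have less: "real (card {y \<in> Y'. G T y}) < real (card Y') / 12" if "T \<in> X'" for T
      using that by force
    have "real (card Y') * (real (card X) / 12) \<le> (\<Sum>y\<in>Y'. real (card {T \<in> X'. G T y}))"
      using deg by (intro sum_bounded_below) auto
    also have "\<dots> = (\<Sum>T\<in>X'. real (card {y \<in> Y'. G T y}))"
    proof -
      have "(\<Sum>y\<in>Y'. card {T \<in> X'. G T y}) = (\<Sum>T\<in>X'. card {y \<in> Y'. G T y})"
        using sum_multicount_gen[of Y' X' "\<lambda>y T. G T y" "\<lambda>T. card {y \<in> Y'. G T y}"] finX finY'
        by (simp add: X'_def)
      from arg_cong[OF this, of real] show ?thesis by simp
    qed
    also have "\<dots> < (\<Sum>T\<in>X'. real (card Y') / 12)"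
      using \<open>X' \<noteq> {}\<close> finX less by (intro sum_strict_mono) (auto simp: X'_def)
    also have "\<dots> = real (card X') * (real (card Y') / 12)" by simp
    also have "\<dots> \<le> real (card X) * (real (card Y') / 12)"
      using finX by (intro mult_right_mono) (auto simp: X'_def card_mono)
    finally show False by simp
  qed
  then obtain T where T: "T \<in> X" "T \<notin> Bad" "real (card Y') / 12 \<le> real (card {y \<in> Y'. G T y})"
    by (auto simp: X'_def)
  define s where "s = sqrt (ip n (?r T) (?r T))"
  define e' where "e' = e(k := (\<lambda>j. (1 / s) * ?r T j))"
  define S' where "S' = S(k := T)"
  have norm: "real m \<le> ip n (?r T) (?r T)" using T(1,2) X(1) by (auto simp: Bad_def)
  have pos: "0 < ip n (?r T) (?r T)" using norm m by linarith
  note ext = orthonormal_extend[OF IH(3) pos, folded s_def, folded e'_def]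
  have "real (card Y) \<le> 12 ^ Suc k * real (card {y \<in> Y'. G T y})"
  proof -
    note IH(2)
    also have "12 ^ k * real (card Y') \<le> 12 ^ k * (12 * real (card {y \<in> Y'. G T y}))"
      using T(3) by (intro mult_left_mono) auto
    finally show ?thesis by simp
  qed
  moreover have "S' l \<in> X \<and> (\<forall>y\<in>{y \<in> Y'. G T y}. G (S' l) y) \<and>
      sqrt (real m) \<le> ip n (indicator (S' l)) (e' l) \<and>
      (\<forall>v. (\<forall>i\<le>l. ip n v (e' i) = 0) \<longrightarrow> ip n v (indicator (S' l)) = 0)" if "l < Suc k" for l
  proof (cases "l = k")
    case True
    then show ?thesis using T(1) ext(2,3) norm by (auto simp: S'_def s_def)
  next
    case False
    then have l: "l < k" using that by simp
    then have "ip n v (indicator (S l)) = 0" if "\<forall>i\<le>l. ip n v (e' i) = 0" for v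
      using that by (intro IH(7)) (auto simp: e'_def)
    then show ?thesis using l IH(4-6)[OF l] by (auto simp: S'_def e'_def)
  qed
  ultimately show ?case using IH(1) ext(1) by (intro exI[of _ S'] exI[of _ e'] exI[of _ "{y \<in> Y'. G T y}"]) auto
qed

section \<open>Anticoncentration on rectangles\<close>

definition bilin :: "nat \<Rightarrow> (nat \<Rightarrow> nat \<Rightarrow> real) \<Rightarrow> nat set \<Rightarrow> (nat \<Rightarrow> real) \<Rightarrow> real" where
  "bilin n A S v = ip n (indicator S) (\<lambda>i. \<Sum>j<n. A i j * v j)"

lemma bilin_diff: "bilin n A S (\<lambda>j. u j - v j) = bilin n A S u - bilin n A S v"
  unfolding bilin_def right_diff_distrib sum_subtractf by (rule ip_diff_right)

text \<open>A crude bound, meant for rounding errors only; \<open>L\<close> will be so large that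
  \<open>n ^ 2\<close> is no more than the half-width of a window.\<close>

lemma bilin_bound:
  assumes "\<And>i j. i < n \<Longrightarrow> j < n \<Longrightarrow> \<bar>A i j\<bar> \<le> 1" "\<And>j. j < n \<Longrightarrow> \<bar>v j\<bar> \<le> 1"
  shows "\<bar>bilin n A S v\<bar> \<le> (real n)\<^sup>2"
proof -
  have "\<bar>bilin n A S v\<bar> \<le> (\<Sum>i<n. \<bar>indicator S i * (\<Sum>j<n. A i j * v j)\<bar>)"
    unfolding bilin_def ip_def by (rule sum_abs)
  also have "\<dots> \<le> (\<Sum>i<n. \<Sum>j<n. 1)"
  proof (rule sum_mono)
    fix i assume i: "i \<in> {..<n}"
    have "\<bar>indicator S i * (\<Sum>j<n. A i j * v j)\<bar> \<le> \<bar>\<Sum>j<n. A i j * v j\<bar>"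
      by (simp add: indicator_def)
    also have "\<dots> \<le> (\<Sum>j<n. \<bar>A i j * v j\<bar>)" by (rule sum_abs)
    also have "\<dots> \<le> (\<Sum>j<n. 1)"
      using assms i by (intro sum_mono) (auto simp: abs_mult intro!: mult_le_one)
    finally show "\<bar>indicator S i * (\<Sum>j<n. A i j * v j)\<bar> \<le> (\<Sum>j<n. 1)" .
  qed
  finally show ?thesis by (simp add: power2_eq_square)
qed

text \<open>Apply \<open>card_l1_ball\<close> with \<open>q = L / (L + 1)\<close>. Then
  \<open>(1 + q) / (1 - q) = 2 L + 1\<close>, and \<open>(1 / q) ^ L <= exp 1 <= 3\<close> makes the
  weight cost at most \<open>27 ^ n\<close>. Hence the ball exceeds the cube of
  \<open>(L + 1) ^ n\<close> points by a factor of at most \<open>54 ^ n\<close>, independent of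
  \<open>L\<close>.\<close>

lemma card_int_l1_ball:
  fixes n L :: nat
  assumes L: "L \<ge> 1"
  defines "Z \<equiv> {z \<in> PiE {..<n} (\<lambda>_. UNIV::int set). (\<Sum>j<n. \<bar>z j\<bar>) \<le> int (3 * n * L)}"
  shows "finite Z" "real (card Z) \<le> 2 ^ (6 * n) * real (L + 1) ^ n"
proof -
  define q where "q = real L / real (L + 1)"
  have q: "0 < q" "q < 1" using L by (auto simp: q_def)
  note ball = card_l1_ball[OF q, where n = n and B = "3 * n * L", folded Z_def]
  show "finite Z" by (rule ball)
  have "(1 + q) / (1 - q) = 2 * real L + 1" using L by (simp add: q_def field_simps)
  then have c: "q ^ (3 * n * L) * real (card Z) \<le> (2 * real L + 1) ^ n" using ball(2) by simp
  have "(1 / q) ^ L \<le> 3"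
  proof -
    have "1 / q = 1 + 1 / real L" using L by (simp add: q_def field_simps)
    also have "\<dots> \<le> exp (1 / real L)" by (rule exp_ge_add_one_self)
    finally have "(1 / q) ^ L \<le> exp (1 / real L) ^ L" using q by (intro power_mono) auto
    also have "\<dots> = exp 1" using L by (simp flip: exp_of_nat_mult)
    also have "\<dots> \<le> 3" by (rule exp_le)
    finally show ?thesis .
  qed
  then have "((1 / q) ^ L) ^ (3 * n) \<le> 3 ^ (3 * n)" using q by (intro power_mono) auto
  moreover have "((1 / q) ^ L) ^ (3 * n) = (1 / q) ^ (3 * n * L)"
    by (simp only: power_mult[symmetric] mult.commute)
  moreover have "(3::real) ^ (3 * n) = 27 ^ n" by (simp add: power_mult)
  ultimately have p: "(1 / q) ^ (3 * n * L) \<le> 27 ^ n" by simp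
  have "real (card Z) = (1 / q) ^ (3 * n * L) * (q ^ (3 * n * L) * real (card Z))"
    using q by (simp add: power_one_over)
  also have "\<dots> \<le> 27 ^ n * (2 * real L + 1) ^ n"
    using p c q by (intro mult_mono) auto
  also have "\<dots> \<le> 27 ^ n * (2 * real (L + 1)) ^ n"
    by (intro mult_left_mono power_mono) auto
  also have "\<dots> = 54 ^ n * real (L + 1) ^ n"
    by (simp add: power_mult_distrib[symmetric])
  also have "\<dots> \<le> 64 ^ n * real (L + 1) ^ n" by (intro mult_right_mono power_mono) auto
  also have "(64::real) ^ n = 2 ^ (6 * n)" by (simp add: power_mult)
  finally show "real (card Z) \<le> 2 ^ (6 * n) * real (L + 1) ^ n" .
qed

text \<open>
  The set of vectors \<open>y\<close> with all \<open>m\<close> forms in a window has \<open>R ^ m\<close> pairwise disjoint translates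
  inside an \<open>l\<^sup>1\<close>-ball that is only exponentially larger than the cube.
\<close>

lemma small_ball_count:
  fixes m n R L :: nat and Y :: "(nat \<Rightarrow> nat) set"
  assumes n: "n = 100 * m" and m: "m \<ge> 1" and R: "R \<ge> 1" and L: "L = 40 * R * n"
    and A: "\<And>i j. i < n \<Longrightarrow> j < n \<Longrightarrow> \<bar>A i j\<bar> \<le> 1"
    and orth: "\<And>i i'. i < n \<Longrightarrow> i' < n \<Longrightarrow> (\<Sum>j<n. A i j * A i' j) = (if i = i' then real n / 2 else 0)"
    and e: "orthonormal n m e"
    and S: "\<And>i l. i < l \<Longrightarrow> l < m \<Longrightarrow> ip n (indicator (S i)) (e l) = 0"
      "\<And>i. i < m \<Longrightarrow> sqrt (real m) \<le> ip n (indicator (S i)) (e i)"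
    and Y: "Y \<subseteq> PiE {..<n} (\<lambda>_. {..L})"
      "\<And>y i. y \<in> Y \<Longrightarrow> i < m \<Longrightarrow>
         \<bar>bilin n A (S i) (\<lambda>j. real (y j)) - t\<bar> \<le> real n * real L / (40 * real R)"
  shows "real (card Y) * real R ^ m \<le> 2 ^ (6 * n) * real (L + 1) ^ n"
proof -
  define s where "s = sqrt (real n) * real L / real R"
  \<comment> \<open>The scale \<open>s\<close> is chosen so that one step moves a form by at least
    \<open>s * sqrt m = n L / (10 R)\<close>, four window half-widths, while fewer than
    \<open>R\<close> steps in each direction keep the l1 norm of the translation at most
    \<open>n L\<close>.\<close>
  define u where "u \<sigma> = lincomb m (\<lambda>l. s * real (\<sigma> l)) e" for \<sigma> :: "nat \<Rightarrow> nat"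
  \<comment> \<open>\<open>v \<sigma>\<close> is the preimage of \<open>u \<sigma>\<close> under
    \<open>A\<close>: the rows of \<open>A\<close> are orthogonal with squared norm
    \<open>n / 2\<close>, so the inverse is \<open>2 / n\<close> times the transpose.\<close>
  define v where "v \<sigma> j = (2 / real n) * (\<Sum>i<n. A i j * u \<sigma> i)" for \<sigma> j
  define \<Sigma> where "\<Sigma> = PiE {..<m} (\<lambda>_. {..<R})"
  define Z where "Z = {z \<in> PiE {..<n} (\<lambda>_. UNIV::int set). (\<Sum>j<n. \<bar>z j\<bar>) \<le> int (3 * n * L)}"
  \<comment> \<open>The translation is rounded down coordinatewise, so that the translates are
    integer points and can be counted.\<close>
  define \<Phi> where "\<Phi> = (\<lambda>(y, \<sigma>). restrict (\<lambda>j. int (y j) + \<lfloor>v \<sigma> j\<rfloor>) {..<n} :: nat \<Rightarrow> int)"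
  have n0: "real n > 0" and L1: "L \<ge> 1" using n m R L by auto
  have Av: "(\<Sum>j<n. A i j * v \<sigma> j) = u \<sigma> i" if "i < n" for i \<sigma>
  proof -
    have "(\<Sum>j<n. A i j * v \<sigma> j) = (2 / real n) * (\<Sum>j<n. \<Sum>i'<n. u \<sigma> i' * (A i j * A i' j))"
      by (simp add: v_def sum_distrib_left mult_ac)
    also have "\<dots> = (2 / real n) * (\<Sum>i'<n. \<Sum>j<n. u \<sigma> i' * (A i j * A i' j))"
      by (subst sum.swap) simp
    also have "\<dots> = (2 / real n) * (\<Sum>i'<n. u \<sigma> i' * (if i = i' then real n / 2 else 0))"
      unfolding sum_distrib_left[symmetric] using orth[OF that] by (intro arg_cong2[where f="(*)"] sum.cong) auto
    also have "\<dots> = u \<sigma> i" using that n0 by (simp add: if_distrib cong: if_cong)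
    finally show ?thesis .
  qed
  have bilin_v: "bilin n A T (v \<sigma>) = ip n (indicator T) (u \<sigma>)" for T \<sigma>
    unfolding bilin_def ip_def using Av by (intro sum.cong) auto
  have l1: "(\<Sum>j<n. \<bar>v \<sigma> j\<bar>) \<le> real n * real L" if "\<sigma> \<in> \<Sigma>" for \<sigma>
  proof -
    \<comment> \<open>The squared norm of \<open>v \<sigma>\<close> is \<open>2 / n\<close> times
      that of \<open>u \<sigma>\<close>, which orthonormality reduces to the sum of squared
      coefficients.\<close>
    have "(\<Sum>j<n. (v \<sigma> j)\<^sup>2) = (\<Sum>j<n. v \<sigma> j * ((2 / real n) * (\<Sum>i<n. A i j * u \<sigma> i)))"
      by (simp add: power2_eq_square v_def)
    also have "\<dots> = (2 / real n) * (\<Sum>j<n. \<Sum>i<n. u \<sigma> i * (A i j * v \<sigma> j))"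
      by (simp add: sum_distrib_left mult_ac)
    also have "\<dots> = (2 / real n) * (\<Sum>i<n. \<Sum>j<n. u \<sigma> i * (A i j * v \<sigma> j))"
      by (subst sum.swap) simp
    also have "\<dots> = (2 / real n) * ip n (u \<sigma>) (u \<sigma>)"
      unfolding sum_distrib_left[symmetric] ip_def using Av by simp
    also have "\<dots> = (2 / real n) * (\<Sum>l<m. (s * real (\<sigma> l))\<^sup>2)"
      unfolding u_def norm_lincomb[OF e] ..
    also have "\<dots> \<le> (2 / real n) * (\<Sum>l<m. (s * real R)\<^sup>2)"
    proof (intro mult_left_mono sum_mono power_mono)
      fix l assume "l \<in> {..<m}"
      then have "\<sigma> l < R" using that by (auto simp: \<Sigma>_def PiE_iff)
      then show "real (\<sigma> l) \<le> real R" by simp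
    qed (auto simp: s_def)
    also have "\<dots> = 2 * real m * (real L)\<^sup>2"
      using n0 R by (simp add: s_def power_mult_distrib)
    also have "\<dots> \<le> real n * (real L)\<^sup>2" by (intro mult_right_mono) (auto simp: n)
    finally have v2: "(\<Sum>j<n. (v \<sigma> j)\<^sup>2) \<le> real n * (real L)\<^sup>2" .
    have "(\<Sum>j<n. \<bar>v \<sigma> j\<bar>) \<le> sqrt (real n * (\<Sum>j<n. (v \<sigma> j)\<^sup>2))" by (rule sum_abs_le_sqrt)
    also have "\<dots> \<le> sqrt ((real n * real L)\<^sup>2)"
      using mult_left_mono[OF v2, of "real n"]
      by (intro real_sqrt_le_mono) (simp add: power2_eq_square mult_ac)
    finally show ?thesis by simp
  qed
  have into: "\<Phi> ` (Y \<times> \<Sigma>) \<subseteq> Z"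
  proof
    fix z assume "z \<in> \<Phi> ` (Y \<times> \<Sigma>)"
    then obtain y \<sigma> where y: "y \<in> Y" and \<sigma>: "\<sigma> \<in> \<Sigma>"
      and z: "z = restrict (\<lambda>j. int (y j) + \<lfloor>v \<sigma> j\<rfloor>) {..<n}" by (auto simp: \<Phi>_def)
    \<comment> \<open>The factor 3 in the radius: the cube, the translation and the rounding
      contribute at most \<open>n L\<close> each.\<close>
    have "real_of_int (\<Sum>j<n. \<bar>z j\<bar>) \<le> (\<Sum>j<n. real L + (\<bar>v \<sigma> j\<bar> + 1))"
      unfolding of_int_sum
    proof (rule sum_mono)
      fix j assume j: "j \<in> {..<n}"
      then have "y j \<le> L" using y Y(1) by (auto simp: PiE_iff subset_iff)
      then have "real (y j) \<le> real L" by simp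
      moreover have "\<bar>real_of_int \<lfloor>v \<sigma> j\<rfloor>\<bar> \<le> \<bar>v \<sigma> j\<bar> + 1" by linarith
      ultimately show "real_of_int \<bar>z j\<bar> \<le> real L + (\<bar>v \<sigma> j\<bar> + 1)" using j by (simp add: z)
    qed
    also have "\<dots> \<le> real n * real L + (real n * real L + real n)"
      using l1[OF \<sigma>] by (simp add: sum.distrib mult.commute)
    also have "\<dots> \<le> real_of_int (int (3 * n * L))" using L1 mult_left_mono[of 1 "real L" "real n"] by (simp add: mult.commute)
    finally have "(\<Sum>j<n. \<bar>z j\<bar>) \<le> int (3 * n * L)" by (simp only: of_int_le_iff)
    then show "z \<in> Z" by (simp add: Z_def z)
  qed
  have inj: "inj_on \<Phi> (Y \<times> \<Sigma>)"
  proof (rule inj_onI, clarify)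
    fix y \<sigma> y' \<tau>
    assume y: "y \<in> Y" "y' \<in> Y" and \<sigma>: "\<sigma> \<in> \<Sigma>" "\<tau> \<in> \<Sigma>" and eq: "\<Phi> (y, \<sigma>) = \<Phi> (y', \<tau>)"
    have eqj: "int (y j) + \<lfloor>v \<sigma> j\<rfloor> = int (y' j) + \<lfloor>v \<tau> j\<rfloor>" if "j < n" for j
      using fun_cong[OF eq, of j] that by (simp add: \<Phi>_def)
    have "\<sigma> = \<tau>"
    proof (rule ccontr)
      assume "\<sigma> \<noteq> \<tau>"
      then obtain i0 where i0: "\<sigma> i0 \<noteq> \<tau> i0" by auto
      \<comment> \<open>At the first difference the form of \<open>S i\<close> isolates coordinate
        \<open>i\<close>: earlier coefficients agree, and later directions are orthogonal to the
        indicator of \<open>S i\<close>.\<close>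
      define i where "i = (LEAST i. \<sigma> i \<noteq> \<tau> i)"
      have i: "\<sigma> i \<noteq> \<tau> i" and below: "\<And>l. l < i \<Longrightarrow> \<sigma> l = \<tau> l"
        unfolding i_def using LeastI[of "\<lambda>i. \<sigma> i \<noteq> \<tau> i", OF i0] by (auto dest: not_less_Least)
      have im: "i < m"
      proof (rule ccontr)
        assume "\<not> i < m"
        then have "\<sigma> i = undefined" "\<tau> i = undefined"
          using \<sigma> unfolding \<Sigma>_def by (auto intro: PiE_arb)
        then show False using i by simp
      qed
      have "bilin n A (S i) (v \<tau>) - bilin n A (S i) (v \<sigma>)
          = (\<Sum>l<m. s * (real (\<tau> l) - real (\<sigma> l)) * ip n (indicator (S i)) (e l))"
        unfolding bilin_v u_def ip_lincomb_right by (simp add: sum_subtractf algebra_simps)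
      also have "\<dots> = (\<Sum>l<m. if l = i then s * (real (\<tau> l) - real (\<sigma> l)) * ip n (indicator (S i)) (e l) else 0)"
        using below S(1) by (intro sum.cong) (auto, metis nat_neq_iff)
      finally have "\<bar>bilin n A (S i) (v \<tau>) - bilin n A (S i) (v \<sigma>)\<bar>
          = s * \<bar>real (\<tau> i) - real (\<sigma> i)\<bar> * \<bar>ip n (indicator (S i)) (e i)\<bar>"
        using im by (simp add: abs_mult s_def)
      also have "\<dots> \<ge> s * 1 * sqrt (real m)"
      proof (intro mult_mono)
        show "1 \<le> \<bar>real (\<tau> i) - real (\<sigma> i)\<bar>" using i by linarith
        show "sqrt (real m) \<le> \<bar>ip n (indicator (S i)) (e i)\<bar>" using S(2)[OF im] by linarith
      qed (auto simp: s_def)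
      also have "s * 1 * sqrt (real m) = real n * real L / (10 * real R)"
      proof -
        have "sqrt (real n) * sqrt (real m) = sqrt ((10 * real m)\<^sup>2)"
          unfolding real_sqrt_mult[symmetric] by (simp add: n power2_eq_square)
        also have "\<dots> = real n / 10" by (simp only: real_sqrt_abs) (simp add: n)
        finally show ?thesis using R unfolding s_def by (simp add: field_simps)
      qed
      finally have low: "real n * real L / (10 * real R) \<le> \<bar>bilin n A (S i) (v \<tau>) - bilin n A (S i) (v \<sigma>)\<bar>" .
      \<comment> \<open>Equal images make \<open>y - y'\<close> the difference of the rounded
        translations, so \<open>d\<close> consists of rounding errors only.\<close>
      define d where "d j = (real (y j) - real (y' j)) - (v \<tau> j - v \<sigma> j)" for j
      have "\<bar>d j\<bar> \<le> 1" if "j < n" for j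
      proof -
        have "real_of_int (int (y j) + \<lfloor>v \<sigma> j\<rfloor>) = real_of_int (int (y' j) + \<lfloor>v \<tau> j\<rfloor>)"
          using eqj[OF that] by simp
        then show ?thesis unfolding d_def by simp linarith
      qed
      then have "\<bar>bilin n A (S i) d\<bar> \<le> (real n)\<^sup>2" using A by (intro bilin_bound) auto
      moreover have "bilin n A (S i) d = (bilin n A (S i) (\<lambda>j. real (y j)) - bilin n A (S i) (\<lambda>j. real (y' j)))
          - (bilin n A (S i) (v \<tau>) - bilin n A (S i) (v \<sigma>))"
        unfolding d_def bilin_diff ..
      ultimately have "real n * real L / (10 * real R) \<le> 2 * (real n * real L / (40 * real R)) + (real n)\<^sup>2"
        using low Y(2)[OF y(1) im] Y(2)[OF y(2) im] by linarith
      \<comment> \<open>The choice \<open>L = 40 R n\<close> makes the rounding loss exactly one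
        half-width. The windows of \<open>y\<close> and \<open>y'\<close> add two more: three in
        all, against a separation of at least four.\<close>
      moreover have "(real n)\<^sup>2 = real n * real L / (40 * real R)"
        using R by (simp add: L power2_eq_square)
      moreover have "real n * real L / (10 * real R) = 4 * (real n * real L / (40 * real R))" by simp
      ultimately have "4 * (real n * real L / (40 * real R)) \<le> 3 * (real n * real L / (40 * real R))" by linarith
      moreover have "0 < real n * real L / (40 * real R)" using n0 L1 R by simp
      ultimately show False by linarith
    qed
    moreover have "y = y'"
    proof
      fix j
      show "y j = y' j"
      proof (cases "j < n")
        case True
        then show ?thesis using eqj[OF True] \<open>\<sigma> = \<tau>\<close> by simp
      next
        case False
        then show ?thesis using y Y(1) PiE_arb[of _ "{..<n}" _ j] by (metis lessThan_iff subsetD)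
      qed
    qed
    ultimately show "y = y' \<and> \<sigma> = \<tau>" by simp
  qed
  note Z = card_int_l1_ball[OF L1, where n = n, folded Z_def]
  have "card (Y \<times> \<Sigma>) \<le> card Z" using inj into Z(1) by (rule card_inj_on_le)
  then have "card Y * R ^ m \<le> card Z" by (simp add: card_cartesian_product \<Sigma>_def card_PiE)
  then have "real (card Y * R ^ m) \<le> real (card Z)" by (rule of_nat_mono)
  then show ?thesis using Z(2) by simp
qed

text \<open>If more than a third of the pairs hit the window, then more than a sixth of
  \<open>Y\<close> hits it with at least a sixth of \<open>X\<close> each. Greedy selection inside
  this part of \<open>Y\<close> and \<open>small_ball_count\<close> bound \<open>R ^ m\<close> by
  \<open>2 ^ (611 m)\<close>, which \<open>R = 2 ^ 612\<close> violates.\<close>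

lemma rectangle_anticoncentration:
  fixes m n R L :: nat and X :: "nat set set" and Y :: "(nat \<Rightarrow> nat) set"
    and A :: "nat \<Rightarrow> nat \<Rightarrow> real" and t :: real
  assumes n: "n = 100 * m" and m: "m \<ge> 1" and R: "R = 2 ^ 612" and L: "L = 40 * R * n"
    and A: "\<And>i j. i < n \<Longrightarrow> j < n \<Longrightarrow> \<bar>A i j\<bar> \<le> 1"
    and orth: "\<And>i i'. i < n \<Longrightarrow> i' < n \<Longrightarrow> (\<Sum>j<n. A i j * A i' j) = (if i = i' then real n / 2 else 0)"
    and X: "X \<subseteq> Pow {..<n}" "2 ^ (96 * m) \<le> real (card X)"
    and Y: "Y \<subseteq> PiE {..<n} (\<lambda>_. {..L})" "real (L + 1) ^ n \<le> 2 ^ (4 * m) * real (card Y)"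
  defines "G \<equiv> \<lambda>S y. \<bar>bilin n A S (\<lambda>j. real (y j)) - t\<bar> \<le> real n * real L / (40 * real R)"
  shows "real (card {(S, y). S \<in> X \<and> y \<in> Y \<and> G S y}) \<le> real (card X) * real (card Y) / 3"
proof (rule ccontr)
  assume "\<not> ?thesis"
  then have many: "real (card X) * real (card Y) / 3 < real (card {(S, y). S \<in> X \<and> y \<in> Y \<and> G S y})" by simp
  have finX: "finite X" using X(1) by (rule finite_subset) auto
  have finY: "finite Y" using Y(1) by (rule finite_subset) (auto intro: finite_PiE)
  define Y1 where "Y1 = {y \<in> Y. real (card X) / 6 \<le> real (card {S \<in> X. G S y})}"
  have Y1: "Y1 \<subseteq> Y" "finite Y1" using finY by (auto simp: Y1_def)
  have "{(S, y). S \<in> X \<and> y \<in> Y \<and> G S y} = (\<lambda>(y, S). (S, y)) ` (SIGMA y:Y. {S \<in> X. G S y})" by force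
  then have "card {(S, y). S \<in> X \<and> y \<in> Y \<and> G S y} = card (SIGMA y:Y. {S \<in> X. G S y})"
    by (simp add: card_image inj_on_def)
  also have "\<dots> = (\<Sum>y\<in>Y. card {S \<in> X. G S y})" using finX finY by (intro card_SigmaI) auto
  finally have "real (card {(S, y). S \<in> X \<and> y \<in> Y \<and> G S y}) = (\<Sum>y\<in>Y. real (card {S \<in> X. G S y}))" by simp
  also have "\<dots> \<le> (\<Sum>y\<in>Y. real (card X) / 6 + (if y \<in> Y1 then real (card X) else 0))"
  proof (rule sum_mono)
    fix y assume "y \<in> Y"
    moreover have "card {S \<in> X. G S y} \<le> card X" using finX by (intro card_mono) auto
    then have "real (card {S \<in> X. G S y}) \<le> real (card X)" by simp
    ultimately show "real (card {S \<in> X. G S y}) \<le> real (card X) / 6 + (if y \<in> Y1 then real (card X) else 0)"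
      by (auto simp: Y1_def)
  qed
  also have "\<dots> = real (card Y) * (real (card X) / 6) + real (card Y1) * real (card X)"
    using finY Y1(1) by (simp add: sum.distrib sum.inter_restrict[symmetric] Int_absorb1 Int_commute)
  finally have "real (card X) * (real (card Y) / 6) < real (card X) * real (card Y1)"
    using many by (simp add: field_simps)
  then have Y16: "real (card Y) / 6 < real (card Y1)"
    by (metis mult_less_cancel_left_pos of_nat_0_less_iff mult_zero_left not_gr0 of_nat_0 order_less_irrefl)
  have deg: "real (card X) / 6 \<le> real (card {S \<in> X. G S y})" if "y \<in> Y1" for y
    using that by (simp add: Y1_def)
  obtain S e Y' where sel: "Y' \<subseteq> Y1" "real (card Y1) \<le> 12 ^ m * real (card Y')" "orthonormal n m e"
    and S: "\<forall>l<m. S l \<in> X \<and> (\<forall>y\<in>Y'. G (S l) y) \<and> sqrt (real m) \<le> ip n (indicator (S l)) (e l) \<and>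
       (\<forall>v. (\<forall>i\<le>l. ip n v (e i) = 0) \<longrightarrow> ip n v (indicator (S l)) = 0)"
    using greedy_selection[where X = X and Y = Y1 and G = G, OF n m X Y1(2) deg order_refl] by auto
  have small: "real (card Y') * real R ^ m \<le> 2 ^ (6 * n) * real (L + 1) ^ n"
  proof (rule small_ball_count[where A = A and e = e and S = S and t = t, OF n m _ L A orth sel(3)])
    show "ip n (indicator (S i)) (e l) = 0" if "i < l" "l < m" for i l
      using S that sel(3) unfolding ip_commute[of n _ "e l"] by (auto simp: orthonormal_def)
    show "\<bar>bilin n A (S i) (\<lambda>j. real (y j)) - t\<bar> \<le> real n * real L / (40 * real R)"
      if "y \<in> Y'" "i < m" for y i using S that by (simp add: G_def)
  qed (use S sel(1) Y1(1) Y(1) R in auto)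
  have "real (card Y1) * real R ^ m \<le> 12 ^ m * real (card Y') * real R ^ m"
    using sel(2) by (rule mult_right_mono) simp
  also have "\<dots> = 12 ^ m * (real (card Y') * real R ^ m)" by (rule mult.assoc)
  also have "\<dots> \<le> 12 ^ m * (2 ^ (6 * n) * real (L + 1) ^ n)"
    using small by (rule mult_left_mono) simp
  also have "\<dots> \<le> 12 ^ m * (2 ^ (6 * n) * (2 ^ (4 * m) * real (card Y)))"
    using Y(2) by (intro mult_left_mono) auto
  also have "\<dots> \<le> 12 ^ m * (2 ^ (6 * n) * (2 ^ (4 * m) * (6 * real (card Y1))))"
    using Y16 by (intro mult_left_mono) auto
  also have "\<dots> = (6 * 12 ^ m * 2 ^ (604 * m)) * real (card Y1)"
    by (simp add: n mult_ac flip: power_add mult.assoc[of "2 ^ (600 * m)"])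
  finally have "real (card Y1) * real R ^ m \<le> real (card Y1) * (6 * 12 ^ m * 2 ^ (604 * m))"
    by (simp only: mult.commute)
  moreover have "0 < real (card Y1)" using Y16 by (smt (verit) of_nat_0_le_iff divide_nonneg_nonneg)
  ultimately have "real R ^ m \<le> 6 * 12 ^ m * 2 ^ (604 * m)" by simp
  \<comment> \<open>In \<open>604 = 600 + 4\<close> the first term is \<open>6 n\<close> from the l1
    ball and the second the density of \<open>Y\<close>; the factors \<open>6\<close> and
    \<open>12 ^ m\<close> cost \<open>3 m\<close> and \<open>4 m\<close> more.\<close>
  also have "\<dots> \<le> 2 ^ (3 * m) * 2 ^ (4 * m) * 2 ^ (604 * m)"
  proof (intro mult_right_mono mult_mono)
    have "(6::real) \<le> 2 ^ 3" by simp
    also have "\<dots> \<le> 2 ^ (3 * m)" using m by (intro power_increasing) auto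
    finally show "(6::real) \<le> 2 ^ (3 * m)" .
    have "(12::real) ^ m \<le> 16 ^ m" by (intro power_mono) auto
    then show "(12::real) ^ m \<le> 2 ^ (4 * m)" by (simp add: power_mult)
  qed auto
  also have "\<dots> = 2 ^ (611 * m)" by (simp flip: power_add)
  also have "\<dots> < 2 ^ (612 * m)" using m by (intro power_strict_increasing) auto
  also have "\<dots> = real R ^ m" by (simp only: R power_mult of_nat_power of_nat_numeral)
  finally show False by simp
qed

section \<open>Smoothness\<close>

text \<open>
  The parameter \<open>B\<close> bounds the sum of the absolute values of the coefficients, and \<open>d\<close> the degree
  of the monomials in each variable.
\<close>

inductive trig_sum :: "real \<Rightarrow> nat \<Rightarrow> real \<Rightarrow> (real \<times> real \<Rightarrow> real) \<Rightarrow> bool" for N where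
  monomial: "\<bar>c\<bar> \<le> B \<Longrightarrow> a \<le> d \<Longrightarrow> b \<le> d \<Longrightarrow>
    trig_sum N d B (\<lambda>(x, y). c * x ^ a * y ^ b * cos (N * x * y + \<phi>))"
| add: "trig_sum N d B f \<Longrightarrow> trig_sum N d B' g \<Longrightarrow> B + B' \<le> B'' \<Longrightarrow> trig_sum N d B'' (\<lambda>z. f z + g z)"

lemma trig_sum_bound:
  assumes "trig_sum N d B f" "z \<in> unit_square"
  shows "\<bar>f z\<bar> \<le> B"
  using assms
proof (induction)
  case (monomial c B a d b \<phi>)
  obtain x y where z: "z = (x, y)" "0 \<le> x" "x \<le> 1" "0 \<le> y" "y \<le> 1" using monomial.prems by auto
  have "\<bar>c * x ^ a * y ^ b * cos (N * x * y + \<phi>)\<bar> = \<bar>c\<bar> * (x ^ a * y ^ b * \<bar>cos (N * x * y + \<phi>)\<bar>)"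
    using z by (simp add: abs_mult)
  also have "\<dots> \<le> \<bar>c\<bar> * 1"
    using z by (intro mult_left_mono mult_le_one power_le_one) auto
  finally show ?case using z monomial by simp
next
  case (add d B f B' g B'')
  then show ?case using abs_triangle_ineq[of "f z" "g z"] by simp
qed

lemma trig_sum_swap:
  assumes "trig_sum N d B f"
  shows "trig_sum N d B (\<lambda>z. f (prod.swap z))"
  using assms
proof (induction)
  case (monomial c B a d b \<phi>)
  have "(\<lambda>z. case prod.swap z of (x, y) \<Rightarrow> c * x ^ a * y ^ b * cos (N * x * y + \<phi>)) =
    (\<lambda>(x, y). c * x ^ b * y ^ a * cos (N * x * y + \<phi>))"
    by (auto simp: mult_ac)
  then show ?case using trig_sum.monomial[OF monomial(1,3,2)] by simp
next
  case (add d B f B' g B'')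
  then show ?case using trig_sum.add[of N d B "\<lambda>z. f (prod.swap z)" B' "\<lambda>z. g (prod.swap z)"] by simp
qed

lemma trig_sum_differentiable:
  assumes "trig_sum N d B f"
  shows "f differentiable (at z)"
  using assms
proof (induction)
  case (monomial c B a d b \<phi>)
  have "(\<lambda>z. c * fst z ^ a * snd z ^ b * cos (N * fst z * snd z + \<phi>)) differentiable (at z)"
    unfolding differentiable_def by (rule exI) (auto intro!: derivative_eq_intros)
  then show ?case by (simp add: case_prod_unfold)
qed (rule differentiable_add)

text \<open>The product rule turns a monomial into two. The power contributes a factor of at most
  \<open>d <= N\<close>, the cosine a factor \<open>N\<close> and one more power of
  \<open>y\<close>; so the coefficient bound grows by \<open>2 N\<close> and the degree by
  one.\<close>

lemma trig_sum_deriv_x: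
  assumes "trig_sum N d B f" "real d \<le> N"
  shows "\<exists>g. trig_sum N (Suc d) (2 * N * B) g \<and>
    (\<forall>x y. ((\<lambda>t. f (t, y)) has_real_derivative g (x, y)) (at x))"
  using assms
proof (induction)
  case (monomial c B a d b \<phi>)
  \<comment> \<open>For \<open>a = 0\<close> the exponent \<open>a - 1\<close> truncates to 0,
    harmlessly as the coefficient vanishes. The phase \<open>pi / 2\<close> in the second function
    writes the negative sine as a cosine.\<close>
  let ?g1 = "\<lambda>(x, y). (c * real a) * x ^ (a - 1) * y ^ b * cos (N * x * y + \<phi>)"
  let ?g2 = "\<lambda>(x, y). (c * N) * x ^ a * y ^ Suc b * cos (N * x * y + (\<phi> + pi / 2))"
  have aN: "real a \<le> N" "0 \<le> N" using monomial by linarith+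
  have "0 \<le> B" using monomial(1) by linarith
  have "trig_sum N (Suc d) (N * B) ?g1"
  proof (rule trig_sum.monomial)
    have "\<bar>c * real a\<bar> = real a * \<bar>c\<bar>" by (simp add: abs_mult)
    also have "\<dots> \<le> N * B" using aN monomial(1) by (intro mult_mono) auto
    finally show "\<bar>c * real a\<bar> \<le> N * B" .
  qed (use monomial in auto)
  moreover have "trig_sum N (Suc d) (N * B) ?g2"
  proof (rule trig_sum.monomial)
    have "\<bar>c * N\<bar> = N * \<bar>c\<bar>" using aN by (simp add: abs_mult)
    also have "\<dots> \<le> N * B" using aN monomial(1) by (intro mult_mono) auto
    finally show "\<bar>c * N\<bar> \<le> N * B" .
  qed (use monomial in auto)
  ultimately have "trig_sum N (Suc d) (2 * N * B) (\<lambda>z. ?g1 z + ?g2 z)"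
    by (rule trig_sum.add) simp
  moreover have "((\<lambda>t. c * t ^ a * y ^ b * cos (N * t * y + \<phi>)) has_real_derivative ?g1 (x, y) + ?g2 (x, y)) (at x)" for x y
    unfolding prod.case
    by (rule derivative_eq_intros refl | simp)+ (simp add: cos_add sin_add algebra_simps)
  ultimately show ?case by (intro exI[of _ "\<lambda>z. ?g1 z + ?g2 z"]) auto
next
  case (add d B f B' g B'')
  then obtain f' g' where
    f': "trig_sum N (Suc d) (2 * N * B) f'" "\<And>x y. ((\<lambda>t. f (t, y)) has_real_derivative f' (x, y)) (at x)" and
    g': "trig_sum N (Suc d) (2 * N * B') g'" "\<And>x y. ((\<lambda>t. g (t, y)) has_real_derivative g' (x, y)) (at x)"
    by blast
  have "0 \<le> N" using add.prems by linarith
  then have "2 * N * B + 2 * N * B' \<le> 2 * N * B''"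
    using mult_left_mono[OF add.hyps(3), of "2 * N"] by (simp add: algebra_simps)
  then have "trig_sum N (Suc d) (2 * N * B'') (\<lambda>z. f' z + g' z)"
    by (rule trig_sum.add[OF f'(1) g'(1)])
  moreover have "((\<lambda>t. f (t, y) + g (t, y)) has_real_derivative f' (x, y) + g' (x, y)) (at x)" for x y
    by (intro DERIV_add f' g')
  ultimately show ?case by blast
qed

lemma trig_sum_deriv_y:
  assumes "trig_sum N d B f" "real d \<le> N"
  shows "\<exists>g. trig_sum N (Suc d) (2 * N * B) g \<and>
    (\<forall>x y. ((\<lambda>t. f (x, t)) has_real_derivative g (x, y)) (at y))"
proof -
  obtain g where g: "trig_sum N (Suc d) (2 * N * B) g"
    "\<And>x y. ((\<lambda>t. f (prod.swap (t, y))) has_real_derivative g (x, y)) (at x)"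
    using trig_sum_deriv_x[OF trig_sum_swap[OF assms(1)] assms(2)] by blast
  then show ?thesis
    using trig_sum_swap[OF g(1)] g(2) by (intro exI[of _ "\<lambda>z. g (prod.swap z)"]) simp
qed

text \<open>Agreement on the interval is enough because the derivative is taken within it. Iterated
  partial derivatives are identified with trigonometric sums only on the square, so nothing stronger
  is available.\<close>

lemma vector_derivative_unit_interval:
  fixes f g :: "real \<Rightarrow> real"
  assumes "x \<in> {0..1}" "\<And>t. t \<in> {0..1} \<Longrightarrow> g t = f t" "(f has_real_derivative D) (at x)"
  shows "vector_derivative g (at x within {0..1}) = D"
proof -
  have "(g has_real_derivative D) (at x within {0..1})"
    by (rule has_field_derivative_transform_within[OF has_field_derivative_at_within[OF assms(3)], where d = 1])
      (use assms(1,2) in auto)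
  then have "(g has_vector_derivative D) (at x within {0..1})"
    by (simp add: has_real_derivative_iff_has_vector_derivative)
  then show ?thesis
    using assms(1) by (intro vector_derivative_within_cbox[of 0 1, simplified]) (auto simp: cbox_interval)
qed

lemma partial_trig_sum:
  assumes "trig_sum N d B f" "real d \<le> N" "\<And>z. z \<in> unit_square \<Longrightarrow> h z = f z"
  shows "\<exists>g. trig_sum N (Suc d) (2 * N * B) g \<and> (\<forall>z\<in>unit_square. partial_x h z = g z)"
    and "\<exists>g. trig_sum N (Suc d) (2 * N * B) g \<and> (\<forall>z\<in>unit_square. partial_y h z = g z)"
proof -
  obtain g where g: "trig_sum N (Suc d) (2 * N * B) g"
    "\<And>x y. ((\<lambda>t. f (t, y)) has_real_derivative g (x, y)) (at x)"
    using trig_sum_deriv_x[OF assms(1,2)] by blast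
  have "partial_x h z = g z" if "z \<in> unit_square" for z
    using that g(2)[of "snd z" "fst z"] assms(3) unfolding partial_x_def
    by (intro vector_derivative_unit_interval[where f = "\<lambda>t. f (t, snd z)"]) auto
  then show "\<exists>g. trig_sum N (Suc d) (2 * N * B) g \<and> (\<forall>z\<in>unit_square. partial_x h z = g z)"
    using g(1) by blast
next
  obtain g where g: "trig_sum N (Suc d) (2 * N * B) g"
    "\<And>x y. ((\<lambda>t. f (x, t)) has_real_derivative g (x, y)) (at y)"
    using trig_sum_deriv_y[OF assms(1,2)] by blast
  have "partial_y h z = g z" if "z \<in> unit_square" for z
    using that g(2)[of "fst z" "snd z"] assms(3) unfolding partial_y_def
    by (intro vector_derivative_unit_interval[where f = "\<lambda>t. f (fst z, t)"]) auto
  then show "\<exists>g. trig_sum N (Suc d) (2 * N * B) g \<and> (\<forall>z\<in>unit_square. partial_y h z = g z)"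
    using g(1) by blast
qed

lemma times_differentiable_trig_sum:
  assumes "trig_sum N d B f" "real (d + n) \<le> N" "\<And>z. z \<in> unit_square \<Longrightarrow> h z = f z"
  shows "times_differentiable n h"
  using assms
proof (induction n arbitrary: d B f h)
  case (Suc n)
  have d: "real d \<le> N" "real (Suc d + n) \<le> N" using Suc.prems(2) by auto
  obtain g g' where g: "trig_sum N (Suc d) (2 * N * B) g" "\<forall>z\<in>unit_square. partial_x h z = g z"
    "trig_sum N (Suc d) (2 * N * B) g'" "\<forall>z\<in>unit_square. partial_y h z = g' z"
    using partial_trig_sum[OF Suc.prems(1) d(1) Suc.prems(3)] by blast
  have "f differentiable_on unit_square"
    using trig_sum_differentiable[OF Suc.prems(1)]
    by (auto simp: differentiable_on_def intro: differentiable_at_withinI)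
  then have "h differentiable_on unit_square"
    unfolding differentiable_on_def using Suc.prems(3)
    by (metis differentiable_transform_within zero_less_one)
  moreover have "times_differentiable n (partial_x h)" "times_differentiable n (partial_y h)"
    using g Suc.IH[OF g(1) d(2)] Suc.IH[OF g(3) d(2)] by blast+
  ultimately show ?case by simp
qed simp

lemma iterated_partial_trig_sum:
  assumes "trig_sum N d B f" "real (d + n) \<le> N" "\<And>z. z \<in> unit_square \<Longrightarrow> h z = f z"
  shows "\<exists>g. trig_sum N (d + n) ((2 * N) ^ n * B) g \<and> (\<forall>z\<in>unit_square. (partial_x ^^ n) h z = g z)"
    and "\<exists>g. trig_sum N (d + n) ((2 * N) ^ n * B) g \<and> (\<forall>z\<in>unit_square. (partial_y ^^ n) h z = g z)"
proof -
  show "\<exists>g. trig_sum N (d + n) ((2 * N) ^ n * B) g \<and> (\<forall>z\<in>unit_square. (partial_x ^^ n) h z = g z)"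
    using assms(2)
  proof (induction n)
    case 0
    then show ?case using assms by auto
  next
    case (Suc n)
    then obtain g where g: "trig_sum N (d + n) ((2 * N) ^ n * B) g" "\<forall>z\<in>unit_square. (partial_x ^^ n) h z = g z"
      by auto
    have "real (d + n) \<le> N" using Suc.prems by simp
    from partial_trig_sum(1)[OF g(1) this, of "(partial_x ^^ n) h"] g(2)
    show ?case by (simp add: mult.assoc)
  qed
  show "\<exists>g. trig_sum N (d + n) ((2 * N) ^ n * B) g \<and> (\<forall>z\<in>unit_square. (partial_y ^^ n) h z = g z)"
    using assms(2)
  proof (induction n)
    case 0
    then show ?case using assms by auto
  next
    case (Suc n)
    then obtain g where g: "trig_sum N (d + n) ((2 * N) ^ n * B) g" "\<forall>z\<in>unit_square. (partial_y ^^ n) h z = g z"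
      by auto
    have "real (d + n) \<le> N" using Suc.prems by simp
    from partial_trig_sum(2)[OF g(1) this, of "(partial_y ^^ n) h"] g(2)
    show ?case by (simp add: mult.assoc)
  qed
qed

text \<open>Each of the \<open>k\<close> derivatives costs a factor \<open>2 N\<close>, which the
  amplitude cancels exactly. The condition \<open>k <= N\<close> keeps the degrees met on the way
  within the range of \<open>trig_sum_deriv_x\<close>.\<close>

lemma cos_product_smooth_class:
  assumes N: "1 \<le> N" "real k \<le> N"
  shows "(\<lambda>(x, y). (1 / (2 * N) ^ k) * cos (N * x * y + \<phi>)) \<in> smooth_class k"
proof -
  let ?a = "1 / (2 * N) ^ k"
  let ?f = "\<lambda>(x, y). ?a * cos (N * x * y + \<phi>)"
  have "1 \<le> (2 * N) ^ k" using N by (intro one_le_power) auto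
  then have a: "0 \<le> ?a" "?a \<le> 1" using N by (auto simp: divide_le_eq)
  have f: "trig_sum N 0 ?a ?f"
    using trig_sum.monomial[of ?a ?a 0 0 0 N \<phi>] a by simp
  have "(partial_x ^^ i) ((partial_y ^^ (k - i)) ?f) z \<in> {-1..1}" if "i \<le> k" "z \<in> unit_square" for i z
  proof -
    have "real (0 + (k - i)) \<le> N" using N(2) by linarith
    from iterated_partial_trig_sum(2)[OF f this refl] obtain g where
      g: "trig_sum N (0 + (k - i)) ((2 * N) ^ (k - i) * ?a) g"
      "\<forall>z\<in>unit_square. (partial_y ^^ (k - i)) ?f z = g z" by blast
    have "real (0 + (k - i) + i) \<le> N" using N(2) that by simp
    from iterated_partial_trig_sum(1)[OF g(1) this, of "(partial_y ^^ (k - i)) ?f"] g(2) obtain g' where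
      g': "trig_sum N (0 + (k - i) + i) ((2 * N) ^ i * ((2 * N) ^ (k - i) * ?a)) g'"
      "\<forall>z\<in>unit_square. (partial_x ^^ i) ((partial_y ^^ (k - i)) ?f) z = g' z" by blast
    have "(2 * N) ^ i * ((2 * N) ^ (k - i) * ?a) = (2 * N) ^ (i + (k - i)) * ?a"
      by (simp only: power_add mult.assoc)
    also have "\<dots> = 1" using that N by simp
    finally show ?thesis using trig_sum_bound[OF g'(1) that(2)] g'(2) that(2) by (simp only: abs_le_iff) auto
  qed
  moreover have "?f z \<in> {-1..1}" if "z \<in> unit_square" for z
    using trig_sum_bound[OF f that] a by (auto simp only: abs_le_iff atLeastAtMost_iff)
  moreover have "times_differentiable k ?f"
    using N by (intro times_differentiable_trig_sum[OF f]) auto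
  ultimately show ?thesis unfolding smooth_class_def by blast
qed

section \<open>The orthogonal matrix, grid distributions and protocols\<close>

text \<open>Equal to \<open>cos (2 pi i j / n - pi / 4)\<close> for positive \<open>n\<close>;
  unsimplified, it is literally the cosine factor of the hard function at the grid point
  \<open>(i / n, j / n)\<close>.\<close>

definition fourier :: "nat \<Rightarrow> nat \<Rightarrow> nat \<Rightarrow> real" where
  "fourier n i j = cos (2 * pi * real n * (real i / real n) * (real j / real n) + (- (pi / 4)))"

text \<open>A full geometric sum over the powers of an \<open>n\<close>-th root of unity other than
  1.\<close>

lemma sum_cis_eq_0:
  fixes a :: int
  assumes n: "n > 0" and a: "\<not> int n dvd a"
  shows "(\<Sum>j<n. cis (2 * pi * real_of_int a * real j / real n)) = 0"
proof -
  define z where "z = cis (2 * pi * real_of_int a / real n)"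
  have pow: "z ^ j = cis (2 * pi * real_of_int a * real j / real n)" for j
    unfolding z_def Complex.DeMoivre by (simp add: mult_ac)
  have "z \<noteq> 1"
  proof
    assume "z = 1"
    then have "cos (2 * pi * real_of_int a / real n) = 1" by (simp add: z_def complex_eq_iff)
    then obtain t :: int where "2 * pi * real_of_int a / real n = real_of_int t * 2 * pi"
      by (auto simp: cos_one_2pi_int)
    then have "real_of_int a = real_of_int (t * int n)" using n by (simp add: field_simps)
    then have "a = t * int n" by (simp only: of_int_eq_iff)
    then show False using a by simp
  qed
  moreover have "z ^ n = 1"
    using n cis_multiple_2pi[of "real_of_int a"] by (simp add: pow mult_ac)
  ultimately have "(\<Sum>j<n. z ^ j) = 0" by (simp add: geometric_sum)
  then show ?thesis by (simp only: pow)
qed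

lemma sum_cos_eq_0:
  fixes a :: int
  assumes "n > 0" "\<not> int n dvd a"
  shows "(\<Sum>j<n. cos (2 * pi * real_of_int a * real j / real n)) = 0"
  using arg_cong[OF sum_cis_eq_0[OF assms], of Re] by simp

text \<open>Unlike for cosines, multiples of \<open>n\<close> are no exception: there each sine is
  zero. This is what disposes of the index sum \<open>i + i'\<close> in the orthogonality
  relation.\<close>

lemma sum_sin_eq_0:
  fixes a :: int
  assumes n: "n > 0"
  shows "(\<Sum>j<n. sin (2 * pi * real_of_int a * real j / real n)) = 0"
proof (cases "int n dvd a")
  case True
  then obtain t where t: "a = int n * t" by auto
  have "sin (2 * pi * real_of_int a * real j / real n) = 0" for j
  proof -
    have "2 * pi * real_of_int a * real j / real n = 2 * pi * real_of_int (t * int j)"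
      using n by (simp add: t)
    then show ?thesis by (metis sin_int_2pin)
  qed
  then show ?thesis by simp
next
  case False
  then show ?thesis using arg_cong[OF sum_cis_eq_0[OF n False], of Im] by simp
qed

text \<open>
  The phase shift by \<open>pi / 4\<close> makes this a rescaled Hartley matrix, which unlike the cosine matrix
  is orthogonal.
\<close>

lemma fourier_orthogonal:
  assumes "i < n" "i' < n"
  shows "(\<Sum>j<n. fourier n i j * fourier n i' j) = (if i = i' then real n / 2 else 0)"
proof -
  have n: "n > 0" using assms by simp
  define c where "c = int i - int i'"
  define s where "s = int i + int i'"
  \<comment> \<open>In the product-to-sum formula the phases cancel in the difference and add up to
    \<open>pi / 2\<close> in the sum, turning the second cosine into a sine.\<close>
  have "fourier n i j * fourier n i' j = (cos (2 * pi * real_of_int c * real j / real n)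
      + sin (2 * pi * real_of_int s * real j / real n)) / 2" for j
  proof -
    let ?x = "2 * pi * real n * (real i / real n) * (real j / real n) + (- (pi / 4))"
    let ?y = "2 * pi * real n * (real i' / real n) * (real j / real n) + (- (pi / 4))"
    have "?x - ?y = 2 * pi * real_of_int c * real j / real n"
      using n by (simp add: c_def field_simps)
    moreover have "?x + ?y = 2 * pi * real_of_int s * real j / real n - pi / 2"
      using n by (simp add: s_def field_simps)
    ultimately have "cos ?x * cos ?y = (cos (2 * pi * real_of_int c * real j / real n)
        + cos (2 * pi * real_of_int s * real j / real n - pi / 2)) / 2"
      by (simp only: cos_times_cos)
    then show ?thesis unfolding fourier_def by (simp only: cos_diff) simp
  qed
  then have "(\<Sum>j<n. fourier n i j * fourier n i' j) =
      ((\<Sum>j<n. cos (2 * pi * real_of_int c * real j / real n))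
      + (\<Sum>j<n. sin (2 * pi * real_of_int s * real j / real n))) / 2"
    by (simp only: sum_divide_distrib[symmetric] sum.distrib)
  also have "(\<Sum>j<n. sin (2 * pi * real_of_int s * real j / real n)) = 0"
    by (rule sum_sin_eq_0[OF n])
  finally have eq: "(\<Sum>j<n. fourier n i j * fourier n i' j) =
      (\<Sum>j<n. cos (2 * pi * real_of_int c * real j / real n)) / 2" by simp
  show ?thesis
  proof (cases "i = i'")
    case True
    then show ?thesis unfolding eq by (simp add: c_def)
  next
    case False
    have "\<not> int n dvd c"
    proof
      assume "int n dvd c"
      moreover have "c \<noteq> 0" "\<bar>c\<bar> < int n" using False assms by (auto simp: c_def)
      ultimately show False using zdvd_not_zless[of "\<bar>c\<bar>" "int n"] by simp
    qed
    then show ?thesis unfolding eq using False sum_cos_eq_0[OF n] by simp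
  qed
qed

section \<open>Distributions on the grid\<close>

text \<open>Reducing modulo \<open>n\<close> keeps every image in the unit interval for positive
  \<open>n\<close>, whatever the support of \<open>p\<close>; it changes nothing for indices below
  \<open>n\<close>.\<close>

definition grid_dist :: "nat \<Rightarrow> nat pmf \<Rightarrow> real measure" where
  "grid_dist n p = distr (measure_pmf p) (restrict_space borel {0..1}) (\<lambda>i. real (i mod n) / real n)"

lemma grid_measurable:
  "(\<lambda>i. real (i mod n) / real n) \<in> measurable (measure_pmf p) (restrict_space borel {0..1})"
  if "n > 0" for p :: "nat pmf"
  using that by (auto intro!: measurable_restrict_space2 simp: divide_le_eq intro: less_imp_le)

lemma grid_dist_unit: "n > 0 \<Longrightarrow> grid_dist n p \<in> unit_distributions"
  unfolding unit_distributions_def grid_dist_def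
  by (auto intro!: measure_pmf.prob_space_distr grid_measurable)

lemma grid_dist_integral:
  fixes g :: "real \<Rightarrow> real"
  assumes n: "n > 0" and p: "set_pmf p \<subseteq> {..<n}" and g: "g \<in> borel_measurable borel"
  shows "(\<integral>x. g x \<partial>grid_dist n p) = (\<Sum>i<n. pmf p i * g (real i / real n))"
proof -
  have "g \<in> borel_measurable (restrict_space borel {0..1})"
    using g by (rule measurable_restrict_space1)
  then have "(\<integral>x. g x \<partial>grid_dist n p) = (\<integral>i. g (real (i mod n) / real n) \<partial>measure_pmf p)"
    unfolding grid_dist_def by (intro integral_distr grid_measurable[OF n])
  also have "\<dots> = (\<Sum>i<n. g (real (i mod n) / real n) * pmf p i)"
    using p by (intro integral_measure_pmf_real) auto
  finally show ?thesis by (simp add: mult.commute)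
qed

lemma grid_dist_integral_pair:
  fixes f :: "real \<times> real \<Rightarrow> real"
  assumes n: "n > 0" and p: "set_pmf p \<subseteq> {..<n}" "set_pmf q \<subseteq> {..<n}"
    and f: "f \<in> borel_measurable borel" "\<And>z. \<bar>f z\<bar> \<le> B"
  shows "(\<integral>z. f z \<partial>(grid_dist n p \<Otimes>\<^sub>M grid_dist n q)) =
    (\<Sum>i<n. \<Sum>j<n. pmf p i * pmf q j * f (real i / real n, real j / real n))"
proof -
  let ?P = "grid_dist n p" and ?Q = "grid_dist n q"
  interpret P: prob_space ?P using grid_dist_unit[OF n] by (simp add: unit_distributions_def)
  interpret Q: prob_space ?Q using grid_dist_unit[OF n] by (simp add: unit_distributions_def)
  interpret PQ: pair_prob_space ?P ?Q ..
  have id: "(\<lambda>x. x) \<in> borel_measurable (grid_dist n r)" for r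
    unfolding grid_dist_def by (simp add: measurable_restrict_space1)
  have "(\<lambda>z. (fst z, snd z)) \<in> measurable (?P \<Otimes>\<^sub>M ?Q) (borel \<Otimes>\<^sub>M borel)"
    by (intro measurable_Pair measurable_compose[OF measurable_fst id] measurable_compose[OF measurable_snd id])
  then have "(\<lambda>z. z) \<in> measurable (?P \<Otimes>\<^sub>M ?Q) borel" by (simp add: borel_prod)
  then have meas: "f \<in> borel_measurable (?P \<Otimes>\<^sub>M ?Q)" using f(1) by (rule measurable_compose)
  have "integrable (?P \<Otimes>\<^sub>M ?Q) f"
    using f(2) by (intro PQ.integrable_const_bound[where B = B] meas) auto
  then have "(\<integral>z. f z \<partial>(?P \<Otimes>\<^sub>M ?Q)) = (\<integral>x. \<integral>y. f (x, y) \<partial>?Q \<partial>?P)"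
    using PQ.integral_fst[of "\<lambda>x y. f (x, y)"] by simp
  also have "\<dots> = (\<integral>x. (\<Sum>j<n. pmf q j * f (x, real j / real n)) \<partial>?P)"
    by (subst grid_dist_integral[OF n p(2)]) (use f(1) in \<open>auto intro: measurable_compose[OF _ f(1)]\<close>)
  also have "\<dots> = (\<Sum>i<n. pmf p i * (\<Sum>j<n. pmf q j * f (real i / real n, real j / real n)))"
    by (rule grid_dist_integral[OF n p(1)]) (auto intro!: borel_measurable_sum borel_measurable_times intro: measurable_compose[OF _ f(1)])
  finally show ?thesis by (simp add: sum_distrib_left mult.assoc)
qed

text \<open>Probabilities proportional to \<open>y\<close>, encoded as the first component of a
  uniform choice from \<open>y j\<close> copies of each \<open>j\<close>.\<close>

definition weight_pmf :: "nat \<Rightarrow> (nat \<Rightarrow> nat) \<Rightarrow> nat pmf" where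
  "weight_pmf n y = map_pmf fst (pmf_of_set (SIGMA j:{..<n}. {..<y j}))"

lemma weight_pmf:
  assumes "(\<Sum>j<n. y j) = b" "b > 0"
  shows "set_pmf (weight_pmf n y) \<subseteq> {..<n}"
    and "j < n \<Longrightarrow> pmf (weight_pmf n y) j = real (y j) / real b"
proof -
  let ?S = "SIGMA j:{..<n}. {..<y j}"
  have card: "card ?S = b" using assms(1) by simp
  have S: "finite ?S" "?S \<noteq> {}" using card assms(2) by (auto simp del: card_SigmaI)
  show "set_pmf (weight_pmf n y) \<subseteq> {..<n}"
    unfolding weight_pmf_def set_map_pmf set_pmf_of_set[OF S(2,1)] by auto
  assume j: "j < n"
  have "?S \<inter> fst -` {j} = {j} \<times> {..<y j}" using j by auto
  then have "card (?S \<inter> fst -` {j}) = y j" by (simp add: card_cartesian_product)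
  then show "pmf (weight_pmf n y) j = real (y j) / real b"
    by (simp add: weight_pmf_def pmf_map measure_pmf_of_set[OF S(2,1)] card)
qed

section \<open>Rectangle partitions and averaging over the shared randomness\<close>

text \<open>Each message splits the rectangle along the sender's side. The main terms add up over
  the partition, and the error \<open>\<kappa>\<close> is paid once per leaf, hence at most
  \<open>2 ^ depth T\<close> times.\<close>

lemma protocol_success_count:
  fixes pa :: "'x \<Rightarrow> 'a" and qb :: "'y \<Rightarrow> 'b" and val :: "'x \<Rightarrow> 'y \<Rightarrow> real"
  assumes fin: "finite X0" "finite Y0"
    and rect: "\<And>X Y r. X \<subseteq> X0 \<Longrightarrow> Y \<subseteq> Y0 \<Longrightarrow>
      real (card {(x, y). x \<in> X \<and> y \<in> Y \<and> \<bar>r - val x y\<bar> \<le> \<epsilon>}) \<le> real (card X) * real (card Y) / 3 + \<kappa>"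
    and \<kappa>: "0 \<le> \<kappa>" and XY: "X \<subseteq> X0" "Y \<subseteq> Y0"
  shows "real (card {(x, y). x \<in> X \<and> y \<in> Y \<and> \<bar>run T (pa x) (qb y) - val x y\<bar> \<le> \<epsilon>})
    \<le> real (card X) * real (card Y) / 3 + 2 ^ depth T * \<kappa>"
  using XY
proof (induction T arbitrary: X Y)
  case (Output r)
  then show ?case using rect by simp
next
  case (Alice \<mu> T U)
  let ?G = "\<lambda>T X. {(x, y). x \<in> X \<and> y \<in> Y \<and> \<bar>run T (pa x) (qb y) - val x y\<bar> \<le> \<epsilon>}"
  define X1 where "X1 = {x \<in> X. \<mu> (pa x)}"
  define X2 where "X2 = {x \<in> X. \<not> \<mu> (pa x)}"
  have finX: "finite X" using Alice.prems fin finite_subset by blast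
  have "X = X1 \<union> X2" "X1 \<inter> X2 = {}" by (auto simp: X1_def X2_def)
  then have cX: "real (card X) = real (card X1) + real (card X2)"
    using finX by (metis card_Un_disjoint finite_Un of_nat_add)
  have sub: "X1 \<subseteq> X0" "X2 \<subseteq> X0" using Alice.prems by (auto simp: X1_def X2_def)
  have "?G (Alice \<mu> T U) X = ?G T X1 \<union> ?G U X2" by (auto simp: X1_def X2_def)
  then have "card (?G (Alice \<mu> T U) X) \<le> card (?G T X1) + card (?G U X2)"
    by (simp only: card_Un_le)
  then have "real (card (?G (Alice \<mu> T U) X)) \<le> real (card (?G T X1)) + real (card (?G U X2))"
    by linarith
  also have "\<dots> \<le> (real (card X1) * real (card Y) / 3 + 2 ^ depth T * \<kappa>)
      + (real (card X2) * real (card Y) / 3 + 2 ^ depth U * \<kappa>)"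
    using Alice.IH(1)[OF sub(1) Alice.prems(2)] Alice.IH(2)[OF sub(2) Alice.prems(2)] by linarith
  also have "\<dots> \<le> (real (card X1) * real (card Y) / 3 + 2 ^ max (depth T) (depth U) * \<kappa>)
      + (real (card X2) * real (card Y) / 3 + 2 ^ max (depth T) (depth U) * \<kappa>)"
    using \<kappa> by (intro add_mono mult_right_mono power_increasing) auto
  also have "\<dots> = real (card X) * real (card Y) / 3 + 2 ^ depth (Alice \<mu> T U) * \<kappa>"
    by (simp add: cX algebra_simps add_divide_distrib)
  finally show ?case .
next
  case (Bob \<mu> T U)
  let ?G = "\<lambda>T Y. {(x, y). x \<in> X \<and> y \<in> Y \<and> \<bar>run T (pa x) (qb y) - val x y\<bar> \<le> \<epsilon>}"
  define Y1 where "Y1 = {y \<in> Y. \<mu> (qb y)}"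
  define Y2 where "Y2 = {y \<in> Y. \<not> \<mu> (qb y)}"
  have finY: "finite Y" using Bob.prems fin finite_subset by blast
  have "Y = Y1 \<union> Y2" "Y1 \<inter> Y2 = {}" by (auto simp: Y1_def Y2_def)
  then have cY: "real (card Y) = real (card Y1) + real (card Y2)"
    using finY by (metis card_Un_disjoint finite_Un of_nat_add)
  have sub: "Y1 \<subseteq> Y0" "Y2 \<subseteq> Y0" using Bob.prems by (auto simp: Y1_def Y2_def)
  have "?G (Bob \<mu> T U) Y = ?G T Y1 \<union> ?G U Y2" by (auto simp: Y1_def Y2_def)
  then have "card (?G (Bob \<mu> T U) Y) \<le> card (?G T Y1) + card (?G U Y2)"
    by (simp only: card_Un_le)
  then have "real (card (?G (Bob \<mu> T U) Y)) \<le> real (card (?G T Y1)) + real (card (?G U Y2))"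
    by linarith
  also have "\<dots> \<le> (real (card X) * real (card Y1) / 3 + 2 ^ depth T * \<kappa>)
      + (real (card X) * real (card Y2) / 3 + 2 ^ depth U * \<kappa>)"
    using Bob.IH(1)[OF Bob.prems(1) sub(1)] Bob.IH(2)[OF Bob.prems(1) sub(2)] by linarith
  also have "\<dots> \<le> (real (card X) * real (card Y1) / 3 + 2 ^ max (depth T) (depth U) * \<kappa>)
      + (real (card X) * real (card Y2) / 3 + 2 ^ max (depth T) (depth U) * \<kappa>)"
    using \<kappa> by (intro add_mono mult_right_mono power_increasing) auto
  also have "\<dots> = real (card X) * real (card Y) / 3 + 2 ^ depth (Bob \<mu> T U) * \<kappa>"
    by (simp add: cY algebra_simps add_divide_distrib)
  finally show ?case .
qed

text \<open>The easy direction of Yao's principle with uniform inputs: the expected number of pairs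
  answered well is at least two thirds of all pairs, whereas each fixed protocol manages a third
  plus at most \<open>2 ^ d * \<kappa>\<close>.\<close>

lemma estimates_depth_lower_bound:
  fixes pa :: "'x \<Rightarrow> real measure" and qb :: "'y \<Rightarrow> real measure" and val :: "'x \<Rightarrow> 'y \<Rightarrow> real"
  assumes M: "estimates M \<epsilon> f" "\<And>T. T \<in> space M \<Longrightarrow> depth T \<le> d"
    and fin: "finite X0" "finite Y0"
    and rect: "\<And>X Y r. X \<subseteq> X0 \<Longrightarrow> Y \<subseteq> Y0 \<Longrightarrow>
      real (card {(x, y). x \<in> X \<and> y \<in> Y \<and> \<bar>r - val x y\<bar> \<le> \<epsilon>}) \<le> real (card X) * real (card Y) / 3 + \<kappa>"
    and \<kappa>: "0 \<le> \<kappa>"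
    and pa: "\<And>x. x \<in> X0 \<Longrightarrow> pa x \<in> unit_distributions"
    and qb: "\<And>y. y \<in> Y0 \<Longrightarrow> qb y \<in> unit_distributions"
    and val: "\<And>x y. x \<in> X0 \<Longrightarrow> y \<in> Y0 \<Longrightarrow> (\<integral>z. f z \<partial>(pa x \<Otimes>\<^sub>M qb y)) = val x y"
  shows "real (card X0) * real (card Y0) \<le> 3 * 2 ^ d * \<kappa>"
proof -
  interpret prob_space M using M(1) by (simp add: estimates_def)
  define G where "G x y = {T \<in> space M. \<bar>run T (pa x) (qb y) - val x y\<bar> \<le> \<epsilon>}" for x y
  have G: "2 / 3 \<le> measure M (G x y)" if "x \<in> X0" "y \<in> Y0" for x y
    using M(1) pa qb val that unfolding estimates_def G_def by force
  \<comment> \<open>A non-measurable event would have measure 0, so the success bound itself forces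
    measurability.\<close>
  have Gsets: "G x y \<in> sets M" if "x \<in> X0" "y \<in> Y0" for x y
    using G[OF that] measure_notin_sets[of "G x y" M] by force
  have int: "integrable M (indicat_real (G x y))" if "x \<in> X0" "y \<in> Y0" for x y
    using Gsets[OF that] by (simp add: integrable_indicator_iff less_top[symmetric])
  let ?Z = "real (card X0) * real (card Y0) / 3 + 2 ^ d * \<kappa>"
  have count: "(\<Sum>(x, y)\<in>X0 \<times> Y0. indicat_real (G x y) T) \<le> ?Z" if T: "T \<in> space M" for T
  proof -
    have "(\<Sum>(x, y)\<in>X0 \<times> Y0. indicat_real (G x y) T) =
        (\<Sum>z\<in>X0 \<times> Y0. if z \<in> {(x, y). T \<in> G x y} then 1 else 0)"
      by (intro sum.cong) (auto simp: indicator_def)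
    also have "\<dots> = real (card (X0 \<times> Y0 \<inter> {(x, y). T \<in> G x y}))"
      using fin by (simp add: sum.If_cases)
    also have "X0 \<times> Y0 \<inter> {(x, y). T \<in> G x y} =
        {(x, y). x \<in> X0 \<and> y \<in> Y0 \<and> \<bar>run T (pa x) (qb y) - val x y\<bar> \<le> \<epsilon>}"
      using T by (auto simp: G_def)
    also have "real (card \<dots>) \<le> real (card X0) * real (card Y0) / 3 + 2 ^ depth T * \<kappa>"
      by (rule protocol_success_count[where X0 = X0 and Y0 = Y0, OF fin rect \<kappa>]) auto
    also have "\<dots> \<le> ?Z"
      using \<kappa> M(2)[OF T] by (intro add_left_mono mult_right_mono power_increasing) auto
    finally show ?thesis .
  qed
  have "real (card X0) * real (card Y0) * (2 / 3) = (\<Sum>(x, y)\<in>X0 \<times> Y0. 2 / 3)"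
    by (simp add: case_prod_unfold card_cartesian_product)
  also have "\<dots> \<le> (\<Sum>(x, y)\<in>X0 \<times> Y0. measure M (G x y))"
    using G by (intro sum_mono) auto
  also have "\<dots> = (\<Sum>(x, y)\<in>X0 \<times> Y0. \<integral>T. indicat_real (G x y) T \<partial>M)"
    using Gsets by (intro sum.cong) auto
  also have "\<dots> = (\<integral>T. (\<Sum>(x, y)\<in>X0 \<times> Y0. indicat_real (G x y) T) \<partial>M)"
    using int by (simp add: case_prod_unfold mem_Times_iff)
  also have "\<dots> \<le> (\<integral>T. ?Z \<partial>M)"
    using int count by (intro integral_mono) (auto simp: case_prod_unfold mem_Times_iff)
  also have "\<dots> = ?Z" by (simp add: prob_space)
  finally show ?thesis by (simp add: field_simps)
qed

text \<open>Pigeonhole. It serves to fix the size of Alice's set and the total weight of Bob's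
  vector, so that one normalisation is valid for all inputs.\<close>

lemma popular_value:
  fixes g :: "'a \<Rightarrow> nat"
  assumes "finite Z" "g ` Z \<subseteq> {1..K}" "Z \<noteq> {}"
  shows "\<exists>v\<in>{1..K}. card Z \<le> K * card {z \<in> Z. g z = v}"
proof (rule ccontr)
  assume "\<not> ?thesis"
  then have less: "K * card {z \<in> Z. g z = v} < card Z" if "v \<in> {1..K}" for v using that by force
  have K: "{1..K} \<noteq> {}" using assms by auto
  have "K * card Z = K * (\<Sum>v\<in>{1..K}. card {z \<in> Z. g z = v})"
    using sum.group[of Z "{1..K}" g "\<lambda>_. 1::nat"] assms by simp
  also have "\<dots> = (\<Sum>v\<in>{1..K}. K * card {z \<in> Z. g z = v})" by (rule sum_distrib_left)
  also have "\<dots> < (\<Sum>v\<in>{1..K}. card Z)" using K less by (intro sum_strict_mono) auto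
  finally show False by simp
qed

section \<open>The lower bound\<close>

lemma eventually_square_le_power: "\<forall>\<^sub>F m in sequentially. C * (real m)\<^sup>2 \<le> 2 ^ m"
proof -
  have "(\<lambda>m. real m / sqrt 2 ^ m) \<longlonglongrightarrow> 0" by (rule lim_n_over_pown) simp
  then have "(\<lambda>m. C * (real m / sqrt 2 ^ m)\<^sup>2) \<longlonglongrightarrow> C * 0\<^sup>2" by (intro tendsto_intros)
  then have "\<forall>\<^sub>F m in sequentially. C * (real m / sqrt 2 ^ m)\<^sup>2 < 1"
    by (intro order_tendstoD(2)) auto
  then show ?thesis
  proof eventually_elim
    case (elim m)
    have "(sqrt 2 ^ m)\<^sup>2 = (2::real) ^ m" by (metis mult.commute power_mult real_sqrt_pow2 zero_le_numeral)
    then show ?case using elim by (simp add: power_divide divide_less_eq)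
  qed
qed

text \<open>The bound on \<open>\<epsilon>\<close> places an estimate's error inside one window of
  the bilinear form, and \<open>large\<close> absorbs into \<open>2 ^ m\<close> the loss from fixing
  the normalisation.\<close>

lemma estimates_depth_gt:
  fixes k m n R L :: nat and \<epsilon> :: real
  assumes m: "m \<ge> 1" and n: "n = 100 * m" and R: "R = 2 ^ 612" and L: "L = 40 * R * n"
    and large: "2 * real n * real L \<le> 2 ^ m"
    and \<epsilon>: "\<epsilon> * (40 * real R * real n * (2 * (2 * pi * real n)) ^ k) \<le> 1"
  defines "f \<equiv> \<lambda>(x, y). (1 / (2 * (2 * pi * real n)) ^ k) * cos (2 * pi * real n * x * y + (- (pi / 4)))"
  assumes M: "estimates M \<epsilon> f" "\<And>T. T \<in> space M \<Longrightarrow> depth T \<le> d"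
  shows "m < d"
proof (rule ccontr)
  assume "\<not> m < d"
  then have dm: "d \<le> m" by simp
  define D where "D = (2 * (2 * pi * real n)) ^ k"
  have n1: "n \<ge> 1" and R1: "R \<ge> 1" and L1: "L \<ge> 1" using m n R L by auto
  have D0: "D > 0" using n1 by (simp add: D_def)

  \<comment> \<open>The empty set carries no uniform distribution. Fixing the most popular size
    keeps at least \<open>2 ^ n / (2 n)\<close> sets.\<close>
  let ?Zx = "Pow {..<n} - {{}}"
  have "finite ?Zx" "card ` ?Zx \<subseteq> {1..n}" "?Zx \<noteq> {}"
    using n1 subset_eq_atLeast0_lessThan_card[of _ n]
    by (auto simp: Suc_le_eq card_gt_0_iff finite_subset[of _ "{..<n}"] atLeast0LessThan)
  from popular_value[OF this] obtain a where a: "1 \<le> a" "a \<le> n"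
    and cx: "card ?Zx \<le> n * card {S \<in> ?Zx. card S = a}" by auto
  define X0 where "X0 = {S \<in> ?Zx. card S = a}"
  have X0: "finite X0" "X0 \<subseteq> Pow {..<n}" by (auto simp: X0_def)
  have cX0: "2 ^ n \<le> 2 * real n * real (card X0)"
  proof -
    have "card ?Zx = 2 ^ n - 1" by (simp add: card_Pow card_Diff_singleton)
    then have "2 ^ n - 1 \<le> n * card X0" using cx by (simp add: X0_def)
    moreover have "(2::nat) \<le> 2 ^ n" using n1 power_increasing[of 1 n "2::nat"] by simp
    ultimately have "2 ^ n \<le> 2 * n * card X0" by linarith
    then have "real (2 ^ n) \<le> real (2 * n * card X0)" by (rule of_nat_mono)
    then show ?thesis by simp
  qed

  let ?P = "PiE {..<n} (\<lambda>_. {..L})"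
  let ?zero = "restrict (\<lambda>_. 0) {..<n} :: nat \<Rightarrow> nat"
  \<comment> \<open>The zero vector cannot be normalised and is removed likewise; the coordinate sum
    then takes at most \<open>n L\<close> values.\<close>
  let ?Zy = "?P - {?zero}"
  have finP: "finite ?P" by (intro finite_PiE) auto
  have cP: "card ?P = (L + 1) ^ n" by (simp add: card_PiE)
  have zero: "?zero \<in> ?P" by auto
  have Lpow: "2 \<le> (L + 1) ^ n"
  proof -
    have "2 \<le> L + 1" using L1 by simp
    also have "\<dots> \<le> (L + 1) ^ n" using n1 by (intro self_le_power) auto
    finally show ?thesis .
  qed
  have cZy: "card ?Zy = (L + 1) ^ n - 1" using finP zero cP by (simp only: card_Diff_singleton)
  have "finite ?Zy" using finP by simp
  moreover have "(\<lambda>y. \<Sum>j<n. y j) ` ?Zy \<subseteq> {1..n * L}"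
  proof
    fix s assume "s \<in> (\<lambda>y. \<Sum>j<n. y j) ` ?Zy"
    then obtain y where y: "y \<in> ?P" "y \<noteq> ?zero" and s: "s = (\<Sum>j<n. y j)" by auto
    have "s \<le> (\<Sum>j<n. L)" unfolding s using y(1) by (intro sum_mono) (auto simp: PiE_iff)
    moreover have "s \<noteq> 0"
    proof
      assume "s = 0"
      then have "y j = ?zero j" for j using y(1) by (cases "j < n") (auto simp: s PiE_iff extensional_def)
      then show False using y(2) by auto
    qed
    ultimately show "s \<in> {1..n * L}" by simp
  qed
  moreover have "?Zy \<noteq> {}"
  proof
    assume "?Zy = {}"
    then have "card ?Zy = 0" by (simp only: card.empty)
    then show False using cZy Lpow by linarith
  qed
  ultimately have "\<exists>v\<in>{1..n * L}. card ?Zy \<le> n * L * card {y \<in> ?Zy. (\<Sum>j<n. y j) = v}"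
    by (rule popular_value)
  then obtain b where "b \<in> {1..n * L}"
    and cy: "card ?Zy \<le> n * L * card {y \<in> ?Zy. (\<Sum>j<n. y j) = b}" ..
  then have b: "1 \<le> b" "b \<le> n * L" by auto
  define Y0 where "Y0 = {y \<in> ?Zy. (\<Sum>j<n. y j) = b}"
  have Y0: "finite Y0" "Y0 \<subseteq> ?P" using finP by (auto simp: Y0_def)
  have cY0: "real (L + 1) ^ n \<le> 2 * real n * real L * real (card Y0)"
  proof -
    have "(L + 1) ^ n - 1 \<le> n * L * card Y0" using cy unfolding cZy Y0_def .
    then have "(L + 1) ^ n \<le> 2 * (n * L * card Y0)" using Lpow by linarith
    then have "real ((L + 1) ^ n) \<le> real (2 * (n * L * card Y0))" by (rule of_nat_mono)
    then show ?thesis by (simp add: mult_ac)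
  qed

  define val where "val S y = (1 / D) / (real a * real b) * bilin n (fourier n) S (\<lambda>j. real (y j))"
    for S and y :: "nat \<Rightarrow> nat"
  \<comment> \<open>The error term pays for rectangles with a side of density below
    \<open>2 ^ (- 3 m)\<close>, which are bounded by their full area.\<close>
  define \<kappa> where "\<kappa> = real (card X0) * real (card Y0) / 2 ^ (3 * m)"

  have rect: "real (card {(S, y). S \<in> X \<and> y \<in> Y \<and> \<bar>r - val S y\<bar> \<le> \<epsilon>}) \<le> real (card X) * real (card Y) / 3 + \<kappa>"
    if XY: "X \<subseteq> X0" "Y \<subseteq> Y0" for X Y r
  proof (cases "real (card X0) \<le> 2 ^ (3 * m) * real (card X) \<and> real (card Y0) \<le> 2 ^ (3 * m) * real (card Y)")
    case True
    define t where "t = r * (D * (real a * real b))"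
    let ?G = "{(S, y). S \<in> X \<and> y \<in> Y \<and>
        \<bar>bilin n (fourier n) S (\<lambda>j. real (y j)) - t\<bar> \<le> real n * real L / (40 * real R)}"
    have fin: "finite X" "finite Y" using XY X0 Y0 finite_subset by blast+
    have "\<bar>bilin n (fourier n) S (\<lambda>j. real (y j)) - t\<bar> \<le> real n * real L / (40 * real R)"
      if "\<bar>r - val S y\<bar> \<le> \<epsilon>" for S y
    proof -
      let ?c = "D * (real a * real b)"
      have c0: "?c > 0" using D0 a b by simp
      have "bilin n (fourier n) S (\<lambda>j. real (y j)) = val S y * ?c"
        using D0 a b by (simp add: val_def)
      then have "\<bar>bilin n (fourier n) S (\<lambda>j. real (y j)) - t\<bar> = \<bar>r - val S y\<bar> * ?c"
      proof -
        have "val S y * ?c - r * ?c = - ((r - val S y) * ?c)" by (simp only: left_diff_distrib minus_diff_eq)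
        then have "\<bar>val S y * ?c - r * ?c\<bar> = \<bar>r - val S y\<bar> * \<bar>?c\<bar>"
          by (simp only: abs_minus_cancel abs_mult[of _ ?c])
        then show ?thesis using \<open>bilin n (fourier n) S (\<lambda>j. real (y j)) = val S y * ?c\<close>
          by (simp only: t_def abs_of_pos[OF c0])
      qed
      also have "\<dots> \<le> \<epsilon> * ?c" using that c0 by (intro mult_right_mono) auto
      \<comment> \<open>Undoing the normalisation multiplies the error by \<open>D a b\<close>,
        where \<open>a <= n\<close> and \<open>b <= n L\<close>.\<close>
      also have "\<dots> \<le> \<epsilon> * (D * (real n * (real n * real L)))"
      proof -
        have "0 \<le> \<epsilon>" using that by linarith
        moreover have "real b \<le> real n * real L" using b(2) by (metis of_nat_le_iff of_nat_mult)
        ultimately show ?thesis using D0 a by (intro mult_left_mono mult_mono) auto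
      qed
      also have "\<dots> = \<epsilon> * (40 * real R * real n * D) * (real n * real L / (40 * real R))"
        using R1 by (simp add: field_simps)
      also have "\<dots> \<le> 1 * (real n * real L / (40 * real R))"
        using \<epsilon> unfolding D_def by (intro mult_right_mono) auto
      finally show ?thesis by simp
    qed
    then have "{(S, y). S \<in> X \<and> y \<in> Y \<and> \<bar>r - val S y\<bar> \<le> \<epsilon>} \<subseteq> ?G" by blast
    moreover have "finite ?G" by (rule finite_subset[of _ "X \<times> Y"]) (use fin in auto)
    ultimately have "real (card {(S, y). S \<in> X \<and> y \<in> Y \<and> \<bar>r - val S y\<bar> \<le> \<epsilon>}) \<le> real (card ?G)"
      by (simp add: card_mono)
    also have "\<dots> \<le> real (card X) * real (card Y) / 3"
    proof (rule rectangle_anticoncentration[OF n m R L])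
      show "\<bar>fourier n i j\<bar> \<le> 1" for i j by (simp add: fourier_def)
      show "(\<Sum>j<n. fourier n i j * fourier n i' j) = (if i = i' then real n / 2 else 0)" if "i < n" "i' < n" for i i'
        using that by (rule fourier_orthogonal)
      show "X \<subseteq> Pow {..<n}" "Y \<subseteq> ?P" using XY X0 Y0 by auto
      \<comment> \<open>Fixing the size costs at most \<open>2 ^ m\<close> and the density in this
        case another \<open>2 ^ (3 m)\<close>, leaving \<open>2 ^ (96 m)\<close> of the
        \<open>2 ^ (100 m)\<close> subsets.\<close>
      have "(2::real) ^ n \<le> 2 ^ m * (2 ^ (3 * m) * real (card X))"
      proof -
        note cX0
        also have "2 * real n * real (card X0) \<le> 2 ^ m * (2 ^ (3 * m) * real (card X))"
        proof (intro mult_mono)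
          have "2 * real n * 1 \<le> 2 * real n * real L" using L1 by (intro mult_left_mono) auto
          then show "2 * real n \<le> 2 ^ m" using large by simp
        qed (use True in auto)
        finally show ?thesis .
      qed
      moreover have "(2::real) ^ n = 2 ^ (4 * m) * 2 ^ (96 * m)" by (simp add: n flip: power_add)
      moreover have "(2::real) ^ m * (2 ^ (3 * m) * real (card X)) = 2 ^ (4 * m) * real (card X)"
        by (simp flip: power_add mult.assoc)
      ultimately show "2 ^ (96 * m) \<le> real (card X)" by simp
      have "real (L + 1) ^ n \<le> 2 ^ m * (2 ^ (3 * m) * real (card Y))"
      proof -
        note cY0
        also have "2 * real n * real L * real (card Y0) \<le> 2 ^ m * (2 ^ (3 * m) * real (card Y))"
          using large True by (intro mult_mono) auto
        finally show ?thesis .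
      qed
      then show "real (L + 1) ^ n \<le> 2 ^ (4 * m) * real (card Y)"
        by (simp flip: power_add mult.assoc)
    qed
    finally show ?thesis by (simp add: \<kappa>_def add_increasing2)
  next
    case False
    have fin: "finite X" "finite Y" using XY X0 Y0 finite_subset by blast+
    have "{(S, y). S \<in> X \<and> y \<in> Y \<and> \<bar>r - val S y\<bar> \<le> \<epsilon>} \<subseteq> X \<times> Y" by auto
    then have "card {(S, y). S \<in> X \<and> y \<in> Y \<and> \<bar>r - val S y\<bar> \<le> \<epsilon>} \<le> card (X \<times> Y)"
      using fin by (intro card_mono) auto
    then have "real (card {(S, y). S \<in> X \<and> y \<in> Y \<and> \<bar>r - val S y\<bar> \<le> \<epsilon>}) \<le> real (card (X \<times> Y))"
      by (rule of_nat_mono)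
    also have "\<dots> = real (card X) * real (card Y)" by (simp add: card_cartesian_product)
    also have "\<dots> \<le> \<kappa>"
    proof -
      have mono: "real (card X) \<le> real (card X0)" "real (card Y) \<le> real (card Y0)"
        using XY X0 Y0 by (auto intro: card_mono)
      from False consider "2 ^ (3 * m) * real (card X) \<le> real (card X0)" |
        "2 ^ (3 * m) * real (card Y) \<le> real (card Y0)" by linarith
      then have "2 ^ (3 * m) * (real (card X) * real (card Y)) \<le> real (card X0) * real (card Y0)"
      proof cases
        case 1
        then have "(2 ^ (3 * m) * real (card X)) * real (card Y) \<le> real (card X0) * real (card Y0)"
          using mono by (intro mult_mono) auto
        then show ?thesis by (simp only: mult.assoc)
      next
        case 2
        then have "real (card X) * (2 ^ (3 * m) * real (card Y)) \<le> real (card X0) * real (card Y0)"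
          using mono by (intro mult_mono) auto
        then show ?thesis by (simp only: mult.left_commute)
      qed
      then show ?thesis by (simp add: \<kappa>_def pos_le_divide_eq mult.commute)
    qed
    finally show ?thesis by (simp add: add_increasing)
  qed

  have f: "f \<in> borel_measurable borel" "\<bar>f z\<bar> \<le> 1 / D" for z
  proof -
    have "continuous_on UNIV f"
      unfolding f_def case_prod_unfold by (intro continuous_intros)
    then show "f \<in> borel_measurable borel" by (rule borel_measurable_continuous_onI)
    have "1 / D * \<bar>cos (2 * pi * real n * fst z * snd z + (- (pi / 4)))\<bar> \<le> 1 / D * 1"
      using D0 by (intro mult_left_mono abs_cos_le_one) auto
    moreover have "f z = 1 / D * cos (2 * pi * real n * fst z * snd z + (- (pi / 4)))"
      by (simp only: f_def D_def case_prod_unfold)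
    moreover have "\<bar>1 / D\<bar> = 1 / D" using D0 by simp
    ultimately show "\<bar>f z\<bar> \<le> 1 / D" by (simp only: abs_mult mult_1_right)
  qed

  have val_eq: "(\<integral>z. f z \<partial>(grid_dist n (pmf_of_set S) \<Otimes>\<^sub>M grid_dist n (weight_pmf n y))) = val S y"
    if S: "S \<in> X0" and y: "y \<in> Y0" for S y
  proof -
    have S': "S \<noteq> {}" "finite S" "S \<subseteq> {..<n}" "card S = a"
      using S finite_subset[of S "{..<n}"] by (auto simp: X0_def)
    have "b > 0" "(\<Sum>j<n. y j) = b" using b y by (auto simp: Y0_def)
    note w = weight_pmf[OF this(2,1)]
    have "(\<integral>z. f z \<partial>(grid_dist n (pmf_of_set S) \<Otimes>\<^sub>M grid_dist n (weight_pmf n y))) =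
      (\<Sum>i<n. \<Sum>j<n. pmf (pmf_of_set S) i * pmf (weight_pmf n y) j * f (real i / real n, real j / real n))"
      using n1 S' w by (intro grid_dist_integral_pair[OF _ _ _ f]) auto
    also have "\<dots> = (\<Sum>i<n. \<Sum>j<n. (1 / D) / (real a * real b) * (indicator S i * (fourier n i j * real (y j))))"
    proof (intro sum.cong refl)
      fix i j assume "i \<in> {..<n}" "j \<in> {..<n}"
      moreover have "f (real i / real n, real j / real n) = (1 / D) * fourier n i j"
        by (simp add: f_def D_def fourier_def)
      ultimately show "pmf (pmf_of_set S) i * pmf (weight_pmf n y) j * f (real i / real n, real j / real n) =
          (1 / D) / (real a * real b) * (indicator S i * (fourier n i j * real (y j)))"
        using w(2)[of j] S' by (simp add: pmf_of_set mult_ac)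
    qed
    also have "\<dots> = val S y"
      by (simp only: val_def bilin_def ip_def sum_distrib_left)
    finally show ?thesis .
  qed

  have "real (card X0) * real (card Y0) \<le> 3 * 2 ^ d * \<kappa>"
  proof (rule estimates_depth_lower_bound[OF M X0(1) Y0(1) rect _ _ _ val_eq])
    show "0 \<le> \<kappa>" by (simp add: \<kappa>_def)
  qed (use n1 in \<open>auto intro: grid_dist_unit\<close>)
  \<comment> \<open>With \<open>d <= m\<close> the leaves pay at most a fraction
    \<open>3 / 4 ^ m\<close> of all pairs, less than 1 already for \<open>m = 1\<close>.\<close>
  also have "\<dots> \<le> 3 * 2 ^ m * \<kappa>"
    using dm by (intro mult_right_mono mult_left_mono power_increasing) (auto simp: \<kappa>_def)
  also have "\<dots> = (3 / 2 ^ (2 * m)) * (real (card X0) * real (card Y0))"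
  proof -
    have "(2::real) ^ (3 * m) = 2 ^ m * 2 ^ (2 * m)" by (simp flip: power_add)
    then show ?thesis by (simp add: \<kappa>_def)
  qed
  finally have le: "1 * (real (card X0) * real (card Y0)) \<le> (3 / 2 ^ (2 * m)) * (real (card X0) * real (card Y0))"
    by simp
  have "real (card X0) \<noteq> 0"
  proof
    assume "real (card X0) = 0"
    with cX0 have "(2::real) ^ n \<le> 0" by simp
    moreover have "(0::real) < 2 ^ n" by simp
    ultimately show False by linarith
  qed
  moreover have "real (card Y0) \<noteq> 0"
  proof
    assume "real (card Y0) = 0"
    with cY0 have "real (L + 1) ^ n \<le> 0" by simp
    moreover have "0 < real (L + 1) ^ n" by (intro zero_less_power) simp
    ultimately show False by linarith
  qed
  ultimately have "0 < real (card X0) * real (card Y0)"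
    by simp
  then have "1 \<le> 3 / (2::real) ^ (2 * m)"
    using le by (simp only: mult_le_cancel_right_pos)
  moreover have "(2::real) ^ 2 \<le> 2 ^ (2 * m)" using m by (intro power_increasing) auto
  ultimately show False by (simp add: field_simps)
qed

theorem theorem4p10:
  fixes k :: nat
  assumes "k \<ge> 1"
  shows "\<exists>c::real. c > 0 \<and>
    (\<forall>\<^sub>F \<epsilon> in at_right 0. \<exists>f\<in>smooth_class k.
       ereal (c * \<epsilon> powr (- 1 / (real k + 1))) \<le> ereal_of_enat (estimation_complexity \<epsilon> f))"
proof -
  define R :: nat where "R = 2 ^ 612"
  \<comment> \<open>\<open>52000 = 1300 * 40\<close>: both \<open>40 R n\<close> and
    \<open>4 pi n <= 13 n = 1300 m\<close> are then at most \<open>C m\<close>. The constant 800000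
    below comes from \<open>2 n L\<close> with \<open>n = 100 m\<close> and
    \<open>L = 40 R n\<close>.\<close>
  define C where "C = 52000 * real R"
  have R1: "real R \<ge> 1" by (simp add: R_def)
  then have C0: "C > 0" by (simp add: C_def)
  have "\<forall>\<^sub>F m in sequentially. (800000 * real R) * (real m)\<^sup>2 \<le> 2 ^ m"
    by (rule eventually_square_le_power)
  then obtain m0 where m0: "\<And>m. m \<ge> m0 \<Longrightarrow> (800000 * real R) * (real m)\<^sup>2 \<le> 2 ^ m"
    by (auto simp: eventually_sequentially)
  \<comment> \<open>Once \<open>\<epsilon>\<close> is below \<open>\<delta>\<close>, its power
    \<open>x\<close> is at least \<open>T\<close>, which forces
    \<open>m >= m0 + k + 1\<close>.\<close>
  define T where "T = C * (real m0 + real k + 1)"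
  define \<delta> where "\<delta> = T powr (- (real k + 1))"
  have T0: "T > 0" using C0 by (simp add: T_def)
  have \<delta>0: "\<delta> > 0" using T0 by (simp add: \<delta>_def)
  have main: "\<exists>f\<in>smooth_class k.
       ereal ((1 / C) * \<epsilon> powr (- 1 / (real k + 1))) \<le> ereal_of_enat (estimation_complexity \<epsilon> f)"
    if \<epsilon>: "0 < \<epsilon>" "\<epsilon> < \<delta>" for \<epsilon>
  proof -
    define x where "x = \<epsilon> powr (- 1 / (real k + 1))"
    define m where "m = nat \<lfloor>x / C\<rfloor>"
    define n where "n = 100 * m"
    define L where "L = 40 * R * n"
    have x0: "x > 0" using \<epsilon> by (simp add: x_def)
    have "T = \<delta> powr (- 1 / (real k + 1))"
    proof -
      have "- (real k + 1) * (- 1 / (real k + 1)) = 1" by (simp add: field_simps)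
      then show ?thesis using T0 by (simp only: \<delta>_def powr_powr powr_one less_imp_le)
    qed
    also have "\<dots> \<le> x" unfolding x_def using \<epsilon> by (intro powr_mono2') auto
    finally have "T \<le> x" .
    then have "real m0 + real k + 1 \<le> x / C" using C0 by (simp add: T_def pos_le_divide_eq mult.commute)
    then have mk: "m0 + k + 1 \<le> m" unfolding m_def by linarith
    have mx: "real m \<le> x / C" "x / C \<le> real (Suc m)"
      using x0 C0 unfolding m_def by (auto simp: le_nat_iff) linarith+
    have m1: "m \<ge> 1" using mk by simp
    have n0: "real n > 0" using m1 by (simp add: n_def)
    have xpow: "x ^ Suc k = 1 / \<epsilon>"
    proof -
      have "x ^ Suc k = x powr real (Suc k)" using x0 by (simp only: powr_realpow)
      also have "\<dots> = \<epsilon> powr (-1)"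
      proof -
        have "- 1 / (real k + 1) * real (Suc k) = - 1" by (simp add: field_simps)
        then show ?thesis by (simp only: x_def powr_powr)
      qed
      finally show ?thesis using \<epsilon> by (simp add: powr_minus_divide)
    qed
    have small: "\<epsilon> * (40 * real R * real n * (2 * (2 * pi * real n)) ^ k) \<le> 1"
    proof -
      \<comment> \<open>One factor \<open>C m\<close> comes from the grid and window,
        \<open>k\<close> more from the amplitude; together with \<open>C m <= x\<close> this
        produces the exponent \<open>k + 1\<close>.\<close>
      have "40 * real R * real n * (2 * (2 * pi * real n)) ^ k \<le> (C * real m) * (C * real m) ^ k"
      proof (rule mult_mono)
        show "40 * real R * real n \<le> C * real m" by (simp add: C_def n_def)
        have "2 * (2 * pi * real n) \<le> 13 * real n"
          using pi_less_4 pi_approx n0 by (intro order_trans[OF _ mult_right_mono[of "4 * pi" 13 "real n"]]) auto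
        also have "\<dots> = 1300 * real m * 1" by (simp add: n_def)
        also have "\<dots> \<le> 1300 * real m * (40 * real R)" using R1 by (intro mult_left_mono) auto
        finally have "2 * (2 * pi * real n) \<le> C * real m" by (simp add: C_def)
        then show "(2 * (2 * pi * real n)) ^ k \<le> (C * real m) ^ k" using n0 by (intro power_mono) auto
      qed (use n0 C0 in auto)
      also have "\<dots> = (C * real m) ^ Suc k" by simp
      also have "\<dots> \<le> x ^ Suc k" using mx(1) C0 by (intro power_mono) (auto simp: field_simps)
      also have "\<dots> = 1 / \<epsilon>" by (rule xpow)
      finally show ?thesis using \<epsilon> by (simp add: field_simps)
    qed
    have large: "2 * real n * real L \<le> 2 ^ m"
    proof -
      have "2 * real n * real L = (800000 * real R) * (real m)\<^sup>2"
        by (simp add: L_def n_def power2_eq_square)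
      also have "\<dots> \<le> 2 ^ m" using mk by (intro m0) auto
      finally show ?thesis .
    qed
    \<comment> \<open>The frequency depends on \<open>\<epsilon>\<close> through \<open>n\<close>,
      so each accuracy has its own hard function.\<close>
    define f where "f = (\<lambda>(x, y). (1 / (2 * (2 * pi * real n)) ^ k) * cos (2 * pi * real n * x * y + (- (pi / 4))))"
    have "1 \<le> 2 * pi * real n \<and> real k \<le> 2 * pi * real n"
    proof -
      have "real k + 1 \<le> real n" using mk by (simp add: n_def)
      also have "1 * real n \<le> 2 * pi * real n" using pi_gt3 n0 by (intro mult_right_mono) auto
      finally show ?thesis by simp
    qed
    then have "f \<in> smooth_class k" unfolding f_def by (intro cos_product_smooth_class) auto
    moreover have "ereal ((1 / C) * \<epsilon> powr (- 1 / (real k + 1))) \<le> ereal_of_enat (estimation_complexity \<epsilon> f)"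
    proof -
      \<comment> \<open>The strict inequality \<open>m < d\<close> compensates the floor in
        \<open>m\<close>, as \<open>x / C\<close> is at most \<open>Suc m\<close>.\<close>
      have "enat (Suc m) \<le> estimation_complexity \<epsilon> f"
        unfolding estimation_complexity_def
      proof (rule Inf_greatest, clarify)
        fix d M assume "estimates M \<epsilon> f" "\<forall>P\<in>space M. depth P \<le> d"
        then have "m < d"
          using estimates_depth_gt[OF m1 n_def R_def L_def large small, folded f_def, of M d] by blast
        then show "enat (Suc m) \<le> enat d" by simp
      qed
      then have "ereal_of_enat (enat (Suc m)) \<le> ereal_of_enat (estimation_complexity \<epsilon> f)"
        by (simp only: ereal_of_enat_le_iff)
      moreover have "ereal ((1 / C) * \<epsilon> powr (- 1 / (real k + 1))) \<le> ereal_of_enat (enat (Suc m))"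
        using mx(2) by (simp add: x_def)
      ultimately show ?thesis by (rule order_trans[rotated])
    qed
    ultimately show ?thesis by blast
  qed
  have "\<forall>\<^sub>F \<epsilon> in at_right 0. \<exists>f\<in>smooth_class k.
       ereal ((1 / C) * \<epsilon> powr (- 1 / (real k + 1))) \<le> ereal_of_enat (estimation_complexity \<epsilon> f)"
    unfolding eventually_at_right_field using main \<delta>0 by auto
  then show ?thesis using C0 by (intro exI[of _ "1 / C"]) simp
qed

end
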